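(* Let $d\geq 3$ and $0<a<b$. Define, for $k\ge 1$, $$\mathcal U_k=\frac1{b-a}\max\{\partial_Sf_n(\omega): n\in\mathbb N, S\subseteq W_n, |S|=k,\omega\in\Omega_n\},$$ $$\mathcal L_k=\frac1{b-a}\min\{\partial_Sf_n(\omega): n\in\mathbb N, S\subseteq W_n, |S|=k,\omega\in\Omega_n\}.$$ Then $$(\mathcal U_1,\mathcal U_2,\mathcal U_3,\mathcal U_4)=(1,1,1,2),\qquad (\mathcal L_1,\mathcal L_2,\mathcal L_3,\mathcal L_4)=(0,-1,-1,-2).$$
   Context: For $n\in\mathbb N$ consider the subgraph of the nearest-neighbor lattice $\mathbb Z^d$ induced by the box $[-2n,2n]^d$; $W_n$ is its set of edges and $\Omega_n=\{a,b\}^{W_n}$ is the set of environments (assignments of passage times $a$ or $b$ to edges). The passage time of a path in $\omega$ is the sum of the values of its edges. A nonzero vector $v\in\mathbb Z^d$ with $nv\in[-2n,2n]^d$ is fixed, and $f_n(\omega)$ is the minimal passage time over all paths in the box from the vertex $0$ to the vertex $nv$. For an edge $j$ and $\delta\in\{a,b\}$, $\sigma_j^\delta:\Omega_n\to\Omega_n$ replaces the $j$-th coordinate by $\delta$ and leaves the others unchanged. For $\varphi:\Omega_n\to\mathbb R$, $\partial_j\varphi=\varphi\circ\sigma_j^b-\varphi\circ\sigma_j^a$. For nonempty $S\subseteq W_n$, $\partial_S\varphi$ is obtained by applying successively all $\partial_j$, $j\in S$ (the order does not matter). *)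

theory Defs
  imports "HOL-Analysis.Finite_Cartesian_Product" "HOL-Library.FuncSet"
begin

definition lattice_box :: "nat \<Rightarrow> (int ^ 'd) set" where
  "lattice_box n = {x. \<forall>i. x $ i \<in> {- 2 * int n .. 2 * int n}}"

definition nn_adj :: "int ^ 'd \<Rightarrow> int ^ 'd \<Rightarrow> bool" where
  "nn_adj x y \<longleftrightarrow> (\<Sum>i\<in>UNIV. \<bar>x $ i - y $ i\<bar>) = 1"

definition box_edges :: "nat \<Rightarrow> (int ^ 'd) set set" where
  "box_edges n = {{x, y} | x y. x \<in> lattice_box n \<and> y \<in> lattice_box n \<and> nn_adj x y}"

type_synonym 'd env = "(int ^ 'd) set \<Rightarrow> real"

definition environments :: "real \<Rightarrow> real \<Rightarrow> nat \<Rightarrow> ('d::finite env) set" where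
  "environments a b n = box_edges n \<rightarrow>\<^sub>E {a, b}"

text \<open>A path is given by its list of pairwise distinct vertices.\<close>

definition path_edges :: "'v list \<Rightarrow> 'v set list" where
  "path_edges p = map (\<lambda>(x, y). {x, y}) (zip p (tl p))"

definition box_paths :: "nat \<Rightarrow> int ^ 'd \<Rightarrow> int ^ 'd \<Rightarrow> (int ^ 'd) list set" where
  "box_paths n x y =
     {p. p \<noteq> [] \<and> hd p = x \<and> last p = y \<and> distinct p \<and>
         set p \<subseteq> lattice_box n \<and> set (path_edges p) \<subseteq> box_edges n}"

definition path_time :: "'d::finite env \<Rightarrow> (int ^ 'd) list \<Rightarrow> real" where
  "path_time \<omega> p = sum_list (map \<omega> (path_edges p))"

definition passage_time :: "int ^ 'd \<Rightarrow> nat \<Rightarrow> 'd::finite env \<Rightarrow> real" where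
  "passage_time v n \<omega> = Min (path_time \<omega> ` box_paths n 0 (int n *s v))"

definition set_coord :: "'e \<Rightarrow> real \<Rightarrow> ('e \<Rightarrow> real) \<Rightarrow> 'e \<Rightarrow> real" where
  "set_coord j \<delta> \<omega> = \<omega>(j := \<delta>)"

definition edge_deriv ::
  "real \<Rightarrow> real \<Rightarrow> 'e \<Rightarrow> (('e \<Rightarrow> real) \<Rightarrow> real) \<Rightarrow> ('e \<Rightarrow> real) \<Rightarrow> real" where
  "edge_deriv a b j \<phi> = (\<lambda>\<omega>. (\<phi> \<circ> set_coord j b) \<omega> - (\<phi> \<circ> set_coord j a) \<omega>)"

definition edges_deriv ::
  "real \<Rightarrow> real \<Rightarrow> 'e set \<Rightarrow> (('e \<Rightarrow> real) \<Rightarrow> real) \<Rightarrow> ('e \<Rightarrow> real) \<Rightarrow> real" where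
  "edges_deriv a b S \<phi> = Finite_Set.fold (edge_deriv a b) \<phi> S"

text \<open>The result of the fold is independent of the order in which \<open>S\<close> is traversed.\<close>

lemma comp_fun_commute_edge_deriv: "comp_fun_commute (edge_deriv a b)"
proof
  fix i j :: 'e
  show "edge_deriv a b j \<circ> edge_deriv a b i = edge_deriv a b i \<circ> edge_deriv a b j"
    by (cases "i = j") (auto simp: fun_eq_iff edge_deriv_def set_coord_def fun_upd_twist)
qed

lemma edges_deriv_empty: "edges_deriv a b {} \<phi> = \<phi>"
  by (simp add: edges_deriv_def)

lemma edges_deriv_insert:
  "finite S \<Longrightarrow> j \<notin> S \<Longrightarrow>
     edges_deriv a b (insert j S) \<phi> = edge_deriv a b j (edges_deriv a b S \<phi>)"
  unfolding edges_deriv_def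
  using comp_fun_commute_edge_deriv
  by (intro comp_fun_commute_on.fold_insert[where S = UNIV])
     (auto simp: comp_fun_commute_def')

definition deriv_values :: "int ^ 'd \<Rightarrow> real \<Rightarrow> real \<Rightarrow> nat \<Rightarrow> real set" where
  "deriv_values v a b k =
     {edges_deriv a b S (passage_time v n) \<omega> | n S \<omega>.
        S \<subseteq> box_edges n \<and> card S = k \<and> \<omega> \<in> environments a b n}"

text \<open>
  The set of values may be infinite, so the maximum and minimum are the order-theoretic
  ones; they are meaningful only where a greatest (least) element exists.
\<close>

definition U_const :: "int ^ 'd \<Rightarrow> real \<Rightarrow> real \<Rightarrow> nat \<Rightarrow> real" where
  "U_const v a b k = 1 / (b - a) * (GREATEST x. x \<in> deriv_values v a b k)"

definition L_const :: "int ^ 'd \<Rightarrow> real \<Rightarrow> real \<Rightarrow> nat \<Rightarrow> real" where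
  "L_const v a b k = 1 / (b - a) * (LEAST x. x \<in> deriv_values v a b k)"

end

theory Submission imports Defs begin

text \<open>
  Bounds: if \<open>F X\<close> is the passage time when exactly the edges \<open>X \<subseteq> S\<close> among \<open>S\<close> are expensive, then
  \<open>F\<close> is increasing with increments at most \<open>b - a\<close>, which settles \<open>k \<le> 2\<close>. For \<open>k = 3\<close> one
  compares the optimal paths of the various \<open>X\<close>; the only configurations not settled this way are
  excluded by exchanging the tails of two optimal paths at a common vertex. The case \<open>k = 4\<close> is a
  difference of two third derivatives.

  Sharpness: in suitable environments only two parallel rows compete, both of the same length, and
  the passage time is a constant plus \<open>b - a\<close> times the minimum of the numbers of expensive edges
  on the two rows. Minima such as \<open>min (x\<^sub>1 + x\<^sub>2 + x\<^sub>3 + x\<^sub>4) 2\<close> realise all extremal values.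
\<close>

section \<open>Walks and minimal passage times in a finite graph\<close>

text \<open>The third-order bound is a fact about paths, not about minima. Take a minimum over an
  arbitrary family of edge sets, each charged a base cost plus \<open>b - a\<close> per expensive
  edge. The set of all three edges at base cost 0 and the three singletons at base cost
  \<open>b - a\<close> give the third difference \<open>2 * (b - a)\<close>; the three pairs at 0
  and the empty set at \<open>b - a\<close> give \<open>- (2 * (b - a))\<close>. What excludes such
  families is the order in which a path visits its edges. Exchanged paths may revisit vertices, so
  minima over simple paths must also be compared with walks; this rests on loop erasure and
  nonnegative weights.

  For sharpness, dimension three supplies two directions besides that of the rows, one for each row.
  Changing rows strictly between the end levels takes at least two expensive edges, one to leave and
  one to enter, which is why minima up to 2 can be realised.\<close>

lemma path_edges_simps [simp]:
  "path_edges [] = []" "path_edges [x] = []"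
  "path_edges (x # y # p) = {x, y} # path_edges (y # p)"
  by (auto simp: path_edges_def)

lemma length_path_edges [simp]: "length (path_edges p) = length p - 1"
  by (simp add: path_edges_def)

lemma nth_path_edges:
  "Suc k < length p \<Longrightarrow> path_edges p ! k = {p ! k, p ! Suc k}"
  by (simp add: path_edges_def nth_tl)

lemma path_edges_append:
  "path_edges (xs @ u # ys) = path_edges (xs @ [u]) @ path_edges (u # ys)"
proof (induction xs)
  case (Cons x xs)
  then show ?case by (cases xs) auto
qed simp

lemma path_edges_take_Suc: "path_edges (take (Suc k) p) = take k (path_edges p)"
proof (rule nth_equalityI)
  fix i assume "i < length (path_edges (take (Suc k) p))"
  then have "Suc i < length p" "i < k" by auto
  then show "path_edges (take (Suc k) p) ! i = take k (path_edges p) ! i"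
    by (simp add: nth_path_edges)
qed auto

lemma path_edges_drop: "path_edges (drop k p) = drop k (path_edges p)"
  by (rule nth_equalityI) (auto simp: nth_path_edges)

text \<open>\<open>take k p\<close> stops just before the common vertex and \<open>drop l q\<close>
  starts with it, so the cut lies before edge \<open>k\<close> of \<open>p\<close> and before edge
  \<open>l\<close> of \<open>q\<close>.\<close>

lemma path_edges_splice:
  assumes "k < length p" "l < length q" "p ! k = q ! l"
  shows "path_edges (take k p @ drop l q) = take k (path_edges p) @ drop l (path_edges q)"
proof -
  have q: "drop l q = q ! l # drop (Suc l) q"
    using assms by (simp add: Cons_nth_drop_Suc)
  have "path_edges (take k p @ drop l q) = path_edges (take k p @ [p ! k]) @ path_edges (drop l q)"
    unfolding q assms(3) by (rule path_edges_append)
  also have "take k p @ [p ! k] = take (Suc k) p"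
    using assms by (simp add: take_Suc_conv_app_nth)
  finally show ?thesis
    by (simp add: path_edges_take_Suc path_edges_drop)
qed

lemma in_path_edgesE:
  assumes "e \<in> set (path_edges p)"
  obtains k where "Suc k < length p" "path_edges p ! k = e" "e = {p ! k, p ! Suc k}"
proof -
  obtain k where k: "k < length (path_edges p)" "path_edges p ! k = e"
    using assms by (meson in_set_conv_nth)
  then have "Suc k < length p" by simp
  with k show thesis using that[of k] by (metis nth_path_edges)
qed

lemma path_edges_subset_vertices:
  "e \<in> set (path_edges p) \<Longrightarrow> e \<subseteq> set p"
  by (erule in_path_edgesE) auto

lemma distinct_path_edges: "distinct p \<Longrightarrow> distinct (path_edges p)"
proof (induction p rule: induct_list012)
  case (3 x y p)
  then show ?case using path_edges_subset_vertices[of "{x, y}" "y # p"] by auto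
qed auto

definition edge_sum :: "('v set \<Rightarrow> real) \<Rightarrow> 'v list \<Rightarrow> real" where
  "edge_sum w p = sum_list (map w (path_edges p))"

lemma edge_sum_simps [simp]:
  "edge_sum w [x] = 0" "edge_sum w (x # y # p) = w {x, y} + edge_sum w (y # p)"
  by (simp_all add: edge_sum_def)

lemma edge_sum_append:
  "edge_sum w (xs @ u # ys) = edge_sum w (xs @ [u]) + edge_sum w (u # ys)"
  unfolding edge_sum_def path_edges_append[of xs u ys] by simp

text \<open>The exchange only regroups the edges of the two walks.\<close>

lemma edge_sum_splice:
  assumes "k < length p" "l < length q" "p ! k = q ! l"
  shows "edge_sum w (take k p @ drop l q) + edge_sum w (take l q @ drop k p)
    = edge_sum w p + edge_sum w q"
proof -
  have *: "sum_list (map w xs) = sum_list (map w (take n xs)) + sum_list (map w (drop n xs))"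
    for n and xs :: "'a set list"
    by (metis append_take_drop_id map_append sum_list_append)
  show ?thesis
    using assms *[of "path_edges p" k] *[of "path_edges q" l]
    by (simp add: edge_sum_def path_edges_splice)
qed

text \<open>Telescoping. As \<open>{x, y} = {y, x}\<close>, the hypothesis controls \<open>h\<close>
  in both directions. The lower bounds for lattice paths are obtained from suitable potentials
  \<open>h\<close>.\<close>

lemma edge_sum_potential:
  assumes "p \<noteq> []" "\<And>x y. {x, y} \<in> set (path_edges p) \<Longrightarrow> h y - h x \<le> w {x, y}"
  shows "h (last p) - h (hd p) \<le> edge_sum w p"
  using assms
proof (induction p rule: induct_list012)
  case (3 x y p)
  have "h y - h x \<le> w {x, y}" using 3 by auto
  moreover have "h (last (y # p)) - h y \<le> edge_sum w (y # p)" using 3 by auto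
  ultimately show ?case by auto
qed auto

text \<open>Vertices may repeat, because exchanging tails can create repetitions.\<close>

definition is_walk :: "'v set set \<Rightarrow> 'v \<Rightarrow> 'v \<Rightarrow> 'v list \<Rightarrow> bool" where
  "is_walk E x y p \<longleftrightarrow> p \<noteq> [] \<and> hd p = x \<and> last p = y \<and> set (path_edges p) \<subseteq> E"

lemma is_walk_splice:
  assumes "is_walk E x y p" "is_walk E x y q" "k < length p" "l < length q" "p ! k = q ! l"
  shows "is_walk E x y (take k p @ drop l q)"
proof -
  have "set (path_edges (take k p @ drop l q)) \<subseteq> E"
    using assms set_take_subset[of k "path_edges p"] set_drop_subset[of l "path_edges q"]
    by (auto simp: path_edges_splice is_walk_def)
  moreover have "hd (take k p @ drop l q) = x"
  proof (cases k)
    case 0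
    then show ?thesis using assms by (auto simp: is_walk_def hd_drop_conv_nth hd_conv_nth)
  next
    case (Suc k')
    then show ?thesis using assms by (auto simp: is_walk_def hd_append)
  qed
  ultimately show ?thesis using assms by (auto simp: is_walk_def)
qed

lemma is_walk_join:
  assumes "is_walk E x y p" "is_walk E y z q"
  shows "is_walk E x z (p @ tl q)" "edge_sum w (p @ tl q) = edge_sum w p + edge_sum w q"
proof -
  obtain xs where p: "p = xs @ [y]"
    using assms(1) by (metis append_butlast_last_id is_walk_def)
  obtain ys where q: "q = y # ys"
    using assms(2) by (metis is_walk_def list.collapse)
  show "edge_sum w (p @ tl q) = edge_sum w p + edge_sum w q"
    using edge_sum_append[of w xs y ys] by (simp add: p q)
  show "is_walk E x z (p @ tl q)"
    using assms by (auto simp: is_walk_def p q path_edges_append[of xs y ys] hd_append)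
qed

text \<open>Cutting out the stretch between two visits of a vertex removes nonnegative weights and
  shortens the walk.\<close>

lemma is_walk_loop_erase:
  assumes "is_walk E x y p" "\<And>e. e \<in> E \<Longrightarrow> 0 \<le> w e"
  shows "\<exists>q. is_walk E x y q \<and> distinct q \<and> edge_sum w q \<le> edge_sum w p"
  using assms(1)
proof (induction p rule: length_induct)
  case (1 p)
  show ?case
  proof (cases "distinct p")
    case False
    then obtain xs ys zs u where p: "p = xs @ [u] @ ys @ [u] @ zs"
      using not_distinct_decomp by blast
    let ?q = "xs @ u # zs"
    have pe: "path_edges p = path_edges (xs @ [u]) @ path_edges (u # ys @ [u]) @ path_edges (u # zs)"
      using path_edges_append[of xs u "ys @ u # zs"] path_edges_append[of "u # ys" u zs]
      by (simp add: p)
    have qe: "path_edges ?q = path_edges (xs @ [u]) @ path_edges (u # zs)"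
      by (rule path_edges_append)
    have "is_walk E x y ?q"
      using "1.prems" pe qe by (auto simp: is_walk_def p hd_append split: if_splits)
    moreover have "0 \<le> sum_list (map w (path_edges (u # ys @ [u])))"
      using "1.prems" pe assms(2) by (intro sum_list_nonneg) (auto simp: is_walk_def)
    then have "edge_sum w ?q \<le> edge_sum w p"
      unfolding edge_sum_def pe qe by simp
    moreover have "length ?q < length p" by (simp add: p)
    ultimately show ?thesis using "1.IH" by (meson order_trans)
  qed (use 1 in auto)
qed

lemma walk_vertices:
  assumes "is_walk E x y p"
  shows "set p \<subseteq> insert x (\<Union>E)"
proof -
  have "p \<noteq> [] \<Longrightarrow> set p \<subseteq> insert (hd p) (\<Union>(set (path_edges p)))" for p :: "'v list"
    by (induction p rule: induct_list012) auto
  from this[of p] show ?thesis using assms unfolding is_walk_def by blast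
qed

section \<open>Minimal passage times\<close>

definition min_time :: "'v set set \<Rightarrow> 'v \<Rightarrow> 'v \<Rightarrow> ('v set \<Rightarrow> real) \<Rightarrow> real" where
  "min_time E x y w = Min (edge_sum w ` {p. is_walk E x y p \<and> distinct p})"

locale finite_graph =
  fixes E :: "'v set set" and x y :: 'v
  assumes finite_vertices: "finite (\<Union>E)"
    and connected: "\<exists>p. is_walk E x y p"
begin

lemma finite_simple_walks: "finite {p. is_walk E x y p \<and> distinct p}"
proof (rule finite_subset)
  show "{p. is_walk E x y p \<and> distinct p} \<subseteq> {p. set p \<subseteq> insert x (\<Union>E) \<and> distinct p}"
    using walk_vertices[of E x y] by blast
  show "finite {p. set p \<subseteq> insert x (\<Union>E) \<and> distinct p}"
    using finite_vertices by (intro finite_subset_distinct) auto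
qed

lemma min_time_le:
  assumes "is_walk E x y p" "\<And>e. e \<in> E \<Longrightarrow> 0 \<le> w e"
  shows "min_time E x y w \<le> edge_sum w p"
proof -
  obtain q where q: "is_walk E x y q" "distinct q" "edge_sum w q \<le> edge_sum w p"
    using is_walk_loop_erase[of E x y p w] assms by blast
  have "min_time E x y w \<le> edge_sum w q"
    unfolding min_time_def using q finite_simple_walks by (intro Min_le) auto
  with q(3) show ?thesis by simp
qed

lemma min_time_attained:
  "\<exists>p. is_walk E x y p \<and> distinct p \<and> min_time E x y w = edge_sum w p"
proof -
  have "{p. is_walk E x y p \<and> distinct p} \<noteq> {}"
    using connected is_walk_loop_erase[where w = "\<lambda>_. 0"] by fastforce
  then have "min_time E x y w \<in> edge_sum w ` {p. is_walk E x y p \<and> distinct p}"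
    unfolding min_time_def using finite_simple_walks by (intro Min_in) auto
  then show ?thesis by auto
qed

end

section \<open>Bounds for the derivatives\<close>

text \<open>The setting of one derivative: \<open>S\<close> is meant for the differentiated edges,
  and \<open>w\<close> for the environment, whose values on \<open>S\<close> get
  overwritten.\<close>

locale switched_edges = finite_graph E x y for E :: "'v set set" and x y :: 'v +
  fixes a b :: real and w :: "'v set \<Rightarrow> real" and S :: "'v set set"
  assumes a_nonneg: "0 \<le> a" and a_le_b: "a \<le> b" and finite_S: "finite S"
    and w_nonneg: "\<And>e. e \<in> E \<Longrightarrow> 0 \<le> w e"
begin

definition switched :: "'v set set \<Rightarrow> 'v set \<Rightarrow> real" where
  "switched X e = (if e \<in> X then b else if e \<in> S then a else w e)"

definition F :: "'v set set \<Rightarrow> real" where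
  "F X = min_time E x y (switched X)"

abbreviation base :: "'v list \<Rightarrow> real" where
  "base \<equiv> edge_sum (switched {})"

text \<open>A sum of indicators rather than a cardinality, so that comparing the same path for
  different \<open>X\<close> is linear arithmetic.\<close>

definition hits :: "'v set set \<Rightarrow> 'v list \<Rightarrow> real" where
  "hits X p = (\<Sum>e\<in>X. of_bool (e \<in> set (path_edges p)))"

text \<open>A simple path uses each edge at most once, so its cost is the base cost plus one
  surcharge per hit.\<close>

definition minimiser :: "'v set set \<Rightarrow> 'v list \<Rightarrow> bool" where
  "minimiser X p \<longleftrightarrow> is_walk E x y p \<and> distinct p \<and> F X = base p + (b - a) * hits X p"

lemma hits_simps [simp]:
  "hits {} p = 0"
  "finite X \<Longrightarrow> e \<notin> X \<Longrightarrow> hits (insert e X) p = of_bool (e \<in> set (path_edges p)) + hits X p"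
  by (simp_all add: hits_def del: sum_of_bool_eq)

lemma switched_nonneg: "e \<in> E \<Longrightarrow> 0 \<le> switched X e"
  using a_nonneg a_le_b w_nonneg by (auto simp: switched_def)

lemma edge_sum_switched:
  assumes "distinct p" "X \<subseteq> S"
  shows "edge_sum (switched X) p = base p + (b - a) * hits X p"
proof -
  let ?A = "set (path_edges p)"
  have "finite X" using assms(2) finite_S finite_subset by blast
  have sw: "switched X e = switched {} e + (b - a) * of_bool (e \<in> X)" for e
    using assms(2) by (auto simp: switched_def)
  have es: "edge_sum v p = (\<Sum>e\<in>?A. v e)" for v
    unfolding edge_sum_def
    by (rule sum_list_distinct_conv_sum_set) (rule distinct_path_edges[OF assms(1)])
  have "(\<Sum>e\<in>?A. of_bool (e \<in> X)) = hits X p"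
    unfolding hits_def using \<open>finite X\<close>
    by (simp add: sum_of_bool_eq Int_commute Collect_mem_eq)
  moreover have "(\<Sum>e\<in>?A. switched X e) = (\<Sum>e\<in>?A. switched {} e + (b - a) * of_bool (e \<in> X))"
    by (intro sum.cong refl sw)
  ultimately show ?thesis
    unfolding es by (simp add: sum.distrib flip: sum_distrib_left)
qed

lemma F_le:
  assumes "is_walk E x y p" "distinct p" "X \<subseteq> S"
  shows "F X \<le> base p + (b - a) * hits X p"
  using min_time_le[OF assms(1), of "switched X"] switched_nonneg edge_sum_switched[OF assms(2,3)]
  by (simp add: F_def)

text \<open>Complements \<open>F_le\<close> for exchanged paths, which need not be simple: if
  \<open>X\<close> is avoided, multiplicities do not matter.\<close>

lemma F_le_base:
  assumes "is_walk E x y p" "X \<inter> set (path_edges p) = {}"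
  shows "F X \<le> base p"
proof -
  have "edge_sum (switched X) p = base p"
    unfolding edge_sum_def using assms(2)
    by (intro arg_cong[where f = sum_list] map_cong) (auto simp: switched_def)
  then show ?thesis
    using min_time_le[OF assms(1), of "switched X"] switched_nonneg by (simp add: F_def)
qed

lemma ex_minimiser:
  assumes "X \<subseteq> S"
  shows "\<exists>p. minimiser X p"
  using min_time_attained[of "switched X"] edge_sum_switched[OF _ assms]
  by (auto simp: F_def minimiser_def)

lemma minimiserD:
  assumes "minimiser X p"
  shows "is_walk E x y p" "distinct p" "F X = base p + (b - a) * hits X p"
    "\<And>Y. Y \<subseteq> S \<Longrightarrow> F Y \<le> F X + (b - a) * (hits Y p - hits X p)"
proof -
  show *: "is_walk E x y p" "distinct p" "F X = base p + (b - a) * hits X p"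
    using assms by (auto simp: minimiser_def)
  show "F Y \<le> F X + (b - a) * (hits Y p - hits X p)" if "Y \<subseteq> S" for Y
    using F_le[OF *(1,2) that] *(3) by (simp add: right_diff_distrib)
qed

lemma F_mono:
  assumes "X \<subseteq> Y" "Y \<subseteq> S"
  shows "F X \<le> F Y"
proof -
  obtain p where p: "minimiser Y p" using ex_minimiser assms by blast
  have "hits X p \<le> hits Y p"
    unfolding hits_def using assms finite_S
    by (intro sum_mono2) (auto intro: finite_subset)
  then have "(b - a) * (hits X p - hits Y p) \<le> 0"
    using a_le_b by (intro mult_nonneg_nonpos) auto
  moreover have "F X \<le> F Y + (b - a) * (hits X p - hits Y p)"
    using minimiserD(4)[OF p, of X] assms by blast
  ultimately show ?thesis by linarith
qed

lemma F_lipschitz: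
  assumes "insert e X \<subseteq> S"
  shows "F (insert e X) \<le> F X + (b - a)"
proof -
  obtain p where p: "minimiser X p" using ex_minimiser assms by blast
  have "finite X" using assms finite_subset[OF _ finite_S, of X] by simp
  then have "hits (insert e X) p - hits X p \<le> 1"
    by (cases "e \<in> X") (simp_all add: insert_absorb)
  then have "(b - a) * (hits (insert e X) p - hits X p) \<le> b - a"
    using a_le_b by (intro mult_left_le) auto
  moreover have "F (insert e X) \<le> F X + (b - a) * (hits (insert e X) p - hits X p)"
    using minimiserD(4)[OF p] assms by blast
  ultimately show ?thesis by linarith
qed

text \<open>One exchanged walk pays no surcharge for \<open>X\<close>, the other none for
  \<open>Y\<close>, and together they have the edges of \<open>p\<close> and
  \<open>q\<close>.\<close>

lemma F_splice:
  assumes "is_walk E x y p" "is_walk E x y q" "k < length p" "l < length q" "p ! k = q ! l"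
    and "X \<inter> (set (take k (path_edges p)) \<union> set (drop l (path_edges q))) = {}"
    and "Y \<inter> (set (take l (path_edges q)) \<union> set (drop k (path_edges p))) = {}"
  shows "F X + F Y \<le> base p + base q"
proof -
  have "F X \<le> base (take k p @ drop l q)"
    using assms by (intro F_le_base is_walk_splice) (simp_all add: path_edges_splice)
  moreover have "F Y \<le> base (take l q @ drop k p)"
    using assms by (intro F_le_base is_walk_splice) (simp_all add: path_edges_splice)
  ultimately show ?thesis using edge_sum_splice[OF assms(3-5), of "switched {}"] by simp
qed

section \<open>The order of edges along a path\<close>

definition before :: "'v list \<Rightarrow> 'v set \<Rightarrow> 'v set \<Rightarrow> bool" where
  "before p e e' \<longleftrightarrow>
     (\<exists>k l. k < l \<and> Suc l < length p \<and> path_edges p ! k = e \<and> path_edges p ! l = e')"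

lemma before_total:
  assumes "e \<in> set (path_edges p)" "e' \<in> set (path_edges p)" "e \<noteq> e'"
  shows "before p e e' \<or> before p e' e"
proof -
  obtain k l where "Suc k < length p" "path_edges p ! k = e" "Suc l < length p" "path_edges p ! l = e'"
    using assms by (meson in_path_edgesE)
  moreover from this have "k < l \<or> l < k" using assms(3) by (metis nat_neq_iff)
  ultimately show ?thesis unfolding before_def by blast
qed

text \<open>Prepares a cut at the vertex where \<open>p\<close> enters \<open>e'\<close>;
  \<open>e\<close> cannot recur after it, since a simple path has distinct edges.\<close>

lemma beforeE:
  assumes "before p e e'" "distinct p"
  obtains l where "Suc l < length p" "path_edges p ! l = e'" "e' = {p ! l, p ! Suc l}"
    "e \<notin> set (drop l (path_edges p))"
proof -
  obtain k l where kl: "k < l" "Suc l < length p" "path_edges p ! k = e" "path_edges p ! l = e'"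
    using assms unfolding before_def by blast
  have "e \<notin> set (drop l (path_edges p))"
  proof
    assume "e \<in> set (drop l (path_edges p))"
    then obtain i where "i < length (drop l (path_edges p))" "drop l (path_edges p) ! i = e"
      by (meson in_set_conv_nth)
    then have "l + i < length (path_edges p)" "path_edges p ! (l + i) = e" by auto
    then show False
      using kl nth_eq_iff_index_eq[OF distinct_path_edges[OF assms(2)], of k "l + i"] by simp
  qed
  then show thesis using that kl nth_path_edges[of l p] by blast
qed

text \<open>Taking \<open>Suc l\<close> edges covers a cut at either end of
  \<open>e\<close>.\<close>

lemma not_in_take_before:
  assumes "before p e e'" "distinct p" "Suc l < length p" "path_edges p ! l = e"
  shows "e' \<notin> set (take (Suc l) (path_edges p))"
proof
  assume "e' \<in> set (take (Suc l) (path_edges p))"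
  then obtain i where i: "i < Suc l" "i < length (path_edges p)" "path_edges p ! i = e'"
    by (auto simp: in_set_conv_nth)
  obtain k l' where kl: "k < l'" "Suc l' < length p" "path_edges p ! k = e" "path_edges p ! l' = e'"
    using assms unfolding before_def by blast
  note inj = nth_eq_iff_index_eq[OF distinct_path_edges[OF assms(2)]]
  have "k < length (path_edges p)" "l < length (path_edges p)" "l' < length (path_edges p)"
    using kl assms(3) by auto
  then have "i = l'" "k = l" using inj[of i l'] inj[of k l] i kl assms(4) by auto
  then show False using i kl by simp
qed

section \<open>Third differences: upper bound\<close>

definition third_diff :: "'v set \<Rightarrow> 'v set \<Rightarrow> 'v set \<Rightarrow> real" where
  "third_diff e1 e2 e3 = F {e1, e2, e3} - F {e1, e2} - F {e1, e3} - F {e2, e3}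
     + F {e1} + F {e2} + F {e3} - F {}"

lemma third_diff_commute:
  "third_diff e2 e1 e3 = third_diff e1 e2 e3" "third_diff e1 e3 e2 = third_diff e1 e2 e3"
  by (simp_all add: third_diff_def insert_commute)

text \<open>If \<open>p\<close> misses \<open>e3\<close>, then \<open>F {e3} = F {}\<close>. The
  other terms pair off into one increment of at most \<open>b - a\<close> and two nonpositive
  differences.\<close>

lemma triple_upper_empty:
  assumes "distinct [e1, e2, e3]" "{e1, e2, e3} \<subseteq> S" "minimiser {} p" "e3 \<notin> set (path_edges p)"
  shows "third_diff e1 e2 e3 \<le> b - a"
proof -
  have "F {e3} \<le> F {}" using minimiserD(4)[OF assms(3), of "{e3}"] assms by simp
  moreover have "F {e3, e1, e2} \<le> F {e1, e2} + (b - a)" using assms by (intro F_lipschitz) auto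
  moreover have "F {e1} \<le> F {e1, e3}" "F {e2} \<le> F {e2, e3}" using assms by (auto intro!: F_mono)
  ultimately show ?thesis by (simp add: third_diff_def insert_commute)
qed

text \<open>If \<open>p\<close> misses \<open>e3\<close>, then \<open>F {e1, e2, e3}\<close> and
  \<open>F {e1, e2}\<close> cancel. Otherwise \<open>F {e3}\<close> or \<open>F {e2}\<close> lies at
  least \<open>b - a\<close> below \<open>F {e1, e2}\<close>, which offsets one of the two
  increments that remain.\<close>

lemma triple_upper_pair:
  assumes "distinct [e1, e2, e3]" "{e1, e2, e3} \<subseteq> S" "minimiser {e1, e2} p"
    and "e3 \<notin> set (path_edges p) \<or> e1 \<in> set (path_edges p)"
  shows "third_diff e1 e2 e3 \<le> b - a"
proof -
  have mono: "F {e1} \<le> F {e1, e3}" "F {e2} \<le> F {e2, e3}" "F {e3} \<le> F {e1, e3}"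
    using assms by (auto intro!: F_mono)
  have lip: "F {e1} \<le> F {} + (b - a)" "F {e2} \<le> F {} + (b - a)" "F {e3} \<le> F {} + (b - a)"
     "F {e2, e1, e3} \<le> F {e1, e3} + (b - a)" "F {e1, e2, e3} \<le> F {e2, e3} + (b - a)"
    using assms by (auto intro!: F_lipschitz)
  note p = minimiserD(4)[OF assms(3)]
  consider "e3 \<notin> set (path_edges p)"
    | "e1 \<in> set (path_edges p)" "e2 \<in> set (path_edges p)" "e3 \<in> set (path_edges p)"
    | "e1 \<in> set (path_edges p)" "e2 \<notin> set (path_edges p)" "e3 \<in> set (path_edges p)"
    using assms(4) by blast
  then show ?thesis
  proof cases
    case 1
    then have "F {e1, e2, e3} \<le> F {e1, e2}" using p[of "{e1, e2, e3}"] assms by simp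
    then show ?thesis using mono lip by (simp add: third_diff_def)
  next
    case 2
    then have "F {e3} \<le> F {e1, e2} - (b - a)" using p[of "{e3}"] assms by simp
    then show ?thesis using mono lip by (simp add: third_diff_def insert_commute)
  next
    case 3
    then have "F {e2} \<le> F {e1, e2} - (b - a)" using p[of "{e2}"] assms by simp
    then show ?thesis using mono lip by (simp add: third_diff_def insert_commute)
  qed
qed

text \<open>
  The case left open by comparing single paths: cutting both paths at a vertex of \<open>e2\<close> and
  exchanging the tails produces one path that avoids \<open>e3\<close> and one that avoids \<open>e1\<close>.
\<close>

lemma triple_upper_splice:
  assumes "distinct [e1, e2, e3]" "{e1, e2, e3} \<subseteq> S" "minimiser {} p" "minimiser {e1, e3} q"
    and "before p e1 e2" "before p e2 e3" "e2 \<in> set (path_edges q)"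
    and "e1 \<notin> set (path_edges q)" "e3 \<notin> set (path_edges q)"
  shows "third_diff e1 e2 e3 \<le> b - a"
proof -
  note p = minimiserD(1-3)[OF assms(3)] and q = minimiserD(1-3)[OF assms(4)]
  obtain k where k: "Suc k < length p" "path_edges p ! k = e2" "e2 = {p ! k, p ! Suc k}"
      "e1 \<notin> set (drop k (path_edges p))"
    using beforeE[OF assms(5) p(2)] .
  have "e3 \<notin> set (take (Suc k) (path_edges p))"
    using not_in_take_before[OF assms(6) p(2) k(1,2)] .
  then have e3: "e3 \<notin> set (take k (path_edges p))"
    using set_take_subset_set_take[of k "Suc k" "path_edges p"] by auto
  have "p ! k \<in> set q" using path_edges_subset_vertices[OF assms(7)] k(3) by auto
  then obtain l where l: "l < length q" "p ! k = q ! l" by (metis in_set_conv_nth)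
  have "F {e3} + F {e1} \<le> base p + base q"
    using p q k e3 l assms set_take_subset[of l "path_edges q"] set_drop_subset[of l "path_edges q"]
    by (intro F_splice[of p q k l]) auto
  then have "F {e3} + F {e1} \<le> F {} + F {e1, e3}"
    using p(3) q(3) assms by simp
  moreover have "F {e3, e1, e2} \<le> F {e1, e2} + (b - a)" using assms by (intro F_lipschitz) auto
  moreover have "F {e2} \<le> F {e2, e3}" using assms by (auto intro!: F_mono)
  ultimately show ?thesis by (simp add: third_diff_def insert_commute)
qed

lemma third_diff_upper:
  assumes "distinct [e1, e2, e3]" "{e1, e2, e3} \<subseteq> S"
  shows "third_diff e1 e2 e3 \<le> b - a"
proof (rule ccontr)
  assume not: "\<not> third_diff e1 e2 e3 \<le> b - a"
  obtain p p12 p13 p23 where p: "minimiser {} p" and p12: "minimiser {e1, e2} p12"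
    and p13: "minimiser {e1, e3} p13" and p23: "minimiser {e2, e3} p23"
    using ex_minimiser[of "{}"] ex_minimiser[of "{e1, e2}"] ex_minimiser[of "{e1, e3}"]
      ex_minimiser[of "{e2, e3}"] assms(2) by auto
  have sym: "minimiser {e2, e1} p12" "minimiser {e3, e1} p13" "minimiser {e3, e2} p23"
    using p12 p13 p23 by (simp_all add: insert_commute)
  note sym = sym p p12 p13 p23
  \<comment> \<open>In a counterexample, the optimal path without expensive edges uses all three
    edges, and the one for a pair avoids that pair but uses the third edge.\<close>
  have in_p: "e1 \<in> set (path_edges p)" "e2 \<in> set (path_edges p)" "e3 \<in> set (path_edges p)"
    using not assms triple_upper_empty[OF _ _ p, of e1 e2 e3] triple_upper_empty[OF _ _ p, of e1 e3 e2]
      triple_upper_empty[OF _ _ p, of e2 e3 e1]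
    by (simp_all add: third_diff_commute) (blast+)?
  have out12: "e1 \<notin> set (path_edges p12)" "e2 \<notin> set (path_edges p12)" "e3 \<in> set (path_edges p12)"
    using not assms sym triple_upper_pair[of e1 e2 e3 p12] triple_upper_pair[of e2 e1 e3 p12]
    by (simp_all add: third_diff_commute) (blast+)?
  have out13: "e1 \<notin> set (path_edges p13)" "e3 \<notin> set (path_edges p13)" "e2 \<in> set (path_edges p13)"
    using not assms sym triple_upper_pair[of e1 e3 e2 p13] triple_upper_pair[of e3 e1 e2 p13]
    by (simp_all add: third_diff_commute) (blast+)?
  have out23: "e2 \<notin> set (path_edges p23)" "e3 \<notin> set (path_edges p23)" "e1 \<in> set (path_edges p23)"
    using not assms sym triple_upper_pair[of e2 e3 e1 p23] triple_upper_pair[of e3 e2 e1 p23]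
    by (simp_all add: third_diff_commute) (blast+)?
  \<comment> \<open>Some edge lies between the other two on \<open>p\<close>. The optimal path for
    the outer two uses it, so the exchange applies there.\<close>
  have no_mid: "\<not> (before p e1 e2 \<and> before p e2 e3)" "\<not> (before p e3 e2 \<and> before p e2 e1)"
    "\<not> (before p e1 e3 \<and> before p e3 e2)" "\<not> (before p e2 e3 \<and> before p e3 e1)"
    "\<not> (before p e2 e1 \<and> before p e1 e3)" "\<not> (before p e3 e1 \<and> before p e1 e2)"
    using not assms sym out12 out13 out23
      triple_upper_splice[of e1 e2 e3 p p13] triple_upper_splice[of e3 e2 e1 p p13]
      triple_upper_splice[of e1 e3 e2 p p12] triple_upper_splice[of e2 e3 e1 p p12]
      triple_upper_splice[of e2 e1 e3 p p23] triple_upper_splice[of e3 e1 e2 p p23]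
    by (simp_all add: third_diff_commute) (blast+)?
  have "before p e1 e2 \<or> before p e2 e1" "before p e1 e3 \<or> before p e3 e1"
    "before p e2 e3 \<or> before p e3 e2"
    using in_p assms(1) by (simp_all add: before_total)
  with no_mid show False by blast
qed

section \<open>Third differences: lower bound\<close>

lemma triple_lower_single:
  assumes "distinct [e1, e2, e3]" "{e1, e2, e3} \<subseteq> S" "minimiser {e1} p"
    and "e1 \<in> set (path_edges p) \<or> e2 \<notin> set (path_edges p)"
  shows "- (b - a) \<le> third_diff e1 e2 e3"
proof -
  have lip: "F {e1, e2} \<le> F {e2} + (b - a)" "F {e1, e3} \<le> F {e3} + (b - a)"
     "F {e2, e3} \<le> F {e3} + (b - a)"
    using assms by (auto intro!: F_lipschitz)
  have mono: "F {} \<le> F {e2}" "F {e1, e3} \<le> F {e1, e2, e3}" "F {e2, e3} \<le> F {e1, e2, e3}"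
    using assms by (auto intro!: F_mono)
  note p = minimiserD(4)[OF assms(3)]
  show ?thesis
  proof (cases "e1 \<in> set (path_edges p)")
    \<comment> \<open>Here \<open>F {e1} - F {}\<close> is at least \<open>b - a\<close> and pays
      for one of two negative increments. In the other case \<open>F {e1, e2} \<le> F {e1}\<close>,
      which leaves only one.\<close>
    case True
    then have "F {} \<le> F {e1} - (b - a)" using p[of "{}"] by simp
    then show ?thesis using mono lip by (simp add: third_diff_def)
  next
    case False
    then have "F {e1, e2} \<le> F {e1}" using p[of "{e1, e2}"] assms by simp
    then show ?thesis using mono lip by (simp add: third_diff_def)
  qed
qed

text \<open>
  Again the case left open by comparing single paths: exchanging the tails at \<open>e3\<close>
  produces a path that avoids both \<open>e1\<close> and \<open>e2\<close>.
\<close>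

lemma triple_lower_splice:
  assumes "distinct [e1, e2, e3]" "{e1, e2, e3} \<subseteq> S" "minimiser {e1} p" "minimiser {e2} q"
    and "before p e2 e3" "before q e3 e1"
    and "e1 \<notin> set (path_edges p)" "e2 \<notin> set (path_edges q)"
  shows "- (b - a) \<le> third_diff e1 e2 e3"
proof -
  note p = minimiserD(1-3)[OF assms(3)] and q = minimiserD(1-3)[OF assms(4)]
  obtain k where k: "Suc k < length p" "path_edges p ! k = e3" "e3 = {p ! k, p ! Suc k}"
      "e2 \<notin> set (drop k (path_edges p))"
    using beforeE[OF assms(5) p(2)] .
  obtain m where m: "Suc m < length q" "path_edges q ! m = e3"
  proof -
    obtain m m' where "m < m'" "Suc m' < length q" "path_edges q ! m = e3"
      using assms(6) unfolding before_def by blast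
    then show thesis using that[of m] by simp
  qed
  \<comment> \<open>The two paths may cross \<open>e3\<close> in opposite directions, so
    \<open>p ! k\<close> can be either end of \<open>e3\<close> on \<open>q\<close>.\<close>
  have "p ! k \<in> {q ! m, q ! Suc m}" using m k nth_path_edges[of m q] by auto
  then obtain l where l: "l \<le> Suc m" "l < length q" "p ! k = q ! l"
    using m(1) that[of m] that[of "Suc m"] by auto
  have "e1 \<notin> set (take (Suc m) (path_edges q))"
    using not_in_take_before[OF assms(6) q(2) m] .
  then have e1: "e1 \<notin> set (take l (path_edges q))"
    using set_take_subset_set_take[OF l(1), of "path_edges q"] by auto
  have "F {} + F {e1, e2} \<le> base p + base q"
    using p q k e1 l assms set_take_subset[of l "path_edges q"] set_drop_subset[of k "path_edges p"]
    by (intro F_splice[of p q k l]) auto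
  then have "F {} + F {e1, e2} \<le> F {e1} + F {e2}"
    using p(3) q(3) assms by simp
  moreover have "F {e2, e3} \<le> F {e3} + (b - a)" using assms by (intro F_lipschitz) auto
  moreover have "F {e1, e3} \<le> F {e1, e2, e3}" using assms by (auto intro!: F_mono)
  ultimately show ?thesis by (simp add: third_diff_def)
qed

lemma third_diff_lower:
  assumes "distinct [e1, e2, e3]" "{e1, e2, e3} \<subseteq> S"
  shows "- (b - a) \<le> third_diff e1 e2 e3"
proof (rule ccontr)
  assume not: "\<not> - (b - a) \<le> third_diff e1 e2 e3"
  obtain p1 p2 p3 where p1: "minimiser {e1} p1" and p2: "minimiser {e2} p2" and p3: "minimiser {e3} p3"
    using ex_minimiser[of "{e1}"] ex_minimiser[of "{e2}"] ex_minimiser[of "{e3}"] assms(2) by auto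
  note mins = p1 p2 p3
  have 1: "e1 \<notin> set (path_edges p1)" "e2 \<in> set (path_edges p1)" "e3 \<in> set (path_edges p1)"
    using not assms mins triple_lower_single[of e1 e2 e3 p1] triple_lower_single[of e1 e3 e2 p1]
    by (simp_all add: third_diff_commute) (blast+)?
  have 2: "e2 \<notin> set (path_edges p2)" "e1 \<in> set (path_edges p2)" "e3 \<in> set (path_edges p2)"
    using not assms mins triple_lower_single[of e2 e1 e3 p2] triple_lower_single[of e2 e3 e1 p2]
    by (simp_all add: third_diff_commute) (blast+)?
  have 3: "e3 \<notin> set (path_edges p3)" "e1 \<in> set (path_edges p3)" "e2 \<in> set (path_edges p3)"
    using not assms mins triple_lower_single[of e3 e1 e2 p3] triple_lower_single[of e3 e2 e1 p3]
    by (simp_all add: third_diff_commute) (blast+)?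
  \<comment> \<open>Let each path orient the side of the triangle \<open>e1\<close>,
    \<open>e2\<close>, \<open>e3\<close> formed by the two edges it uses. By exchange, no corner has
    one incoming and one outgoing side, so each is a source or a sink. Neighbouring corners then
    have opposite types, which a triangle does not allow.\<close>
  have no: "\<not> (before p1 e2 e3 \<and> before p2 e3 e1)" "\<not> (before p2 e1 e3 \<and> before p1 e3 e2)"
    "\<not> (before p1 e3 e2 \<and> before p3 e2 e1)" "\<not> (before p3 e1 e2 \<and> before p1 e2 e3)"
    "\<not> (before p2 e3 e1 \<and> before p3 e1 e2)" "\<not> (before p3 e2 e1 \<and> before p2 e1 e3)"
    using not assms mins 1 2 3
      triple_lower_splice[of e1 e2 e3 p1 p2] triple_lower_splice[of e2 e1 e3 p2 p1]
      triple_lower_splice[of e1 e3 e2 p1 p3] triple_lower_splice[of e3 e1 e2 p3 p1]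
      triple_lower_splice[of e2 e3 e1 p2 p3] triple_lower_splice[of e3 e2 e1 p3 p2]
    by (simp_all add: third_diff_commute) (blast+)?
  have "before p1 e2 e3 \<or> before p1 e3 e2" "before p2 e1 e3 \<or> before p2 e3 e1"
    "before p3 e1 e2 \<or> before p3 e2 e1"
    using 1 2 3 assms(1) by (simp_all add: before_total)
  with no show False by blast
qed

text \<open>The edges in \<open>S\<close> are overwritten, so the derivative is an alternating sum of values of \<open>F\<close>.\<close>

lemma edges_deriv_single:
  assumes "S = {e}"
  shows "edges_deriv a b {e} (min_time E x y) w = F {e} - F {}"
proof -
  have "switched {e} = set_coord e b w" "switched {} = set_coord e a w"
    by (simp_all add: fun_eq_iff switched_def set_coord_def) (simp_all add: assms)
  then show ?thesis
    by (simp add: edges_deriv_insert edges_deriv_empty edge_deriv_def F_def)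
qed

lemma edges_deriv_triple:
  assumes "S = {e1, e2, e3}" "distinct [e1, e2, e3]"
  shows "edges_deriv a b {e1, e2, e3} (min_time E x y) w = third_diff e1 e2 e3"
proof -
  have ne: "e1 \<noteq> e2" "e2 \<noteq> e1" "e1 \<noteq> e3" "e3 \<noteq> e1" "e2 \<noteq> e3" "e3 \<noteq> e2"
    using assms(2) unfolding distinct.simps list.set by blast+
  have in_S: "e1 \<in> S" "e2 \<in> S" "e3 \<in> S" using assms(1) by simp_all
  \<comment> \<open>The updates are nested in the order in which \<open>edges_deriv_insert\<close>
    peels off the edges: \<open>e1\<close> acts on \<open>w\<close> first.\<close>
  have sw: "switched X = set_coord e3 (if e3 \<in> X then b else a)
      (set_coord e2 (if e2 \<in> X then b else a) (set_coord e1 (if e1 \<in> X then b else a) w))"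
    if sub: "X \<subseteq> S" for X
  proof
    fix e
    consider "e = e1" | "e = e2" | "e = e3" | "e \<noteq> e1" "e \<noteq> e2" "e \<noteq> e3" "e \<notin> S" "e \<notin> X"
      using sub assms(1) by blast
    then show "switched X e = set_coord e3 (if e3 \<in> X then b else a)
      (set_coord e2 (if e2 \<in> X then b else a) (set_coord e1 (if e1 \<in> X then b else a) w)) e"
      by cases (simp_all add: switched_def set_coord_def in_S ne)
  qed
  show ?thesis
    unfolding third_diff_def F_def
    by (simp add: sw in_S ne edges_deriv_insert edges_deriv_empty edge_deriv_def)
qed

end

section \<open>Derivatives of order one to four\<close>

context finite_graph
begin

context
  fixes a b :: real
  assumes a: "0 \<le> a" and ab: "a \<le> b"
begin

lemma edges_deriv_bounds1:
  assumes "\<And>e. e \<in> E \<Longrightarrow> 0 \<le> w e"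
  shows "edges_deriv a b {e} (min_time E x y) w \<in> {0..b - a}"
proof -
  interpret switched_edges E x y a b w "{e}" by unfold_locales (use a ab assms in auto)
  show ?thesis
    using F_mono[of "{}" "{e}"] F_lipschitz[of e "{}"] by (simp add: edges_deriv_single)
qed

lemma edges_deriv_bounds2:
  assumes "\<And>e. e \<in> E \<Longrightarrow> 0 \<le> w e" "e1 \<noteq> e2"
  shows "edges_deriv a b {e1, e2} (min_time E x y) w \<in> {- (b - a)..b - a}"
proof -
  have "edges_deriv a b {e2} (min_time E x y) (set_coord e1 c w) \<in> {0..b - a}" if "c \<in> {a, b}" for c
    using that a ab assms(1) by (intro edges_deriv_bounds1) (auto simp: set_coord_def)
  from this[of a] this[of b] show ?thesis
    using assms(2) by (simp add: edges_deriv_insert edge_deriv_def)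
qed

lemma edges_deriv_bounds3:
  assumes "\<And>e. e \<in> E \<Longrightarrow> 0 \<le> w e" "distinct [e1, e2, e3]"
  shows "edges_deriv a b {e1, e2, e3} (min_time E x y) w \<in> {- (b - a)..b - a}"
proof -
  interpret switched_edges E x y a b w "{e1, e2, e3}" by unfold_locales (use a ab assms in auto)
  show ?thesis
    using third_diff_upper[OF assms(2)] third_diff_lower[OF assms(2)]
    by (simp add: edges_deriv_triple[OF refl assms(2)])
qed

text \<open>The crude estimate is sharp here, because the two third derivatives can be extremal with
  opposite signs.\<close>

lemma edges_deriv_bounds4:
  assumes "\<And>e. e \<in> E \<Longrightarrow> 0 \<le> w e" "distinct [e1, e2, e3, e4]"
  shows "edges_deriv a b {e1, e2, e3, e4} (min_time E x y) w \<in> {- (2 * (b - a))..2 * (b - a)}"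
proof -
  have "edges_deriv a b {e2, e3, e4} (min_time E x y) (set_coord e1 c w) \<in> {- (b - a)..b - a}"
    if "c \<in> {a, b}" for c
  proof (rule edges_deriv_bounds3)
    show "0 \<le> set_coord e1 c w e" if "e \<in> E" for e
      using \<open>c \<in> {a, b}\<close> that a ab assms(1) by (auto simp: set_coord_def)
    show "distinct [e2, e3, e4]" using assms(2) by simp
  qed
  from this[of a] this[of b] show ?thesis
    using assms(2) by (simp add: edges_deriv_insert edge_deriv_def)
qed

end

end

section \<open>Lattice boxes\<close>

definition l1_dist :: "int ^ 'd \<Rightarrow> int ^ 'd \<Rightarrow> int" where
  "l1_dist x y = (\<Sum>i\<in>UNIV. \<bar>x $ i - y $ i\<bar>)"

text \<open>The smallest axis-parallel box containing both points, that is, the union of all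
  shortest lattice walks between them.\<close>

definition cell :: "int ^ 'd \<Rightarrow> int ^ 'd \<Rightarrow> (int ^ 'd) set" where
  "cell x y = {z. \<forall>i. min (x $ i) (y $ i) \<le> z $ i \<and> z $ i \<le> max (x $ i) (y $ i)}"

lemma l1_dist_remove:
  "l1_dist x y = \<bar>x $ c - y $ c\<bar> + (\<Sum>i\<in>UNIV - {c}. \<bar>x $ i - y $ i\<bar>)"
  unfolding l1_dist_def by (rule sum.remove) auto

lemma nn_adj_iff:
  "nn_adj x y \<longleftrightarrow> (\<exists>c. \<bar>x $ c - y $ c\<bar> = 1 \<and> (\<forall>i. i \<noteq> c \<longrightarrow> x $ i = y $ i))"
proof
  assume adj: "nn_adj x y"
  have "\<exists>c. x $ c \<noteq> y $ c"
  proof (rule ccontr)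
    assume "\<nexists>c. x $ c \<noteq> y $ c"
    then show False using adj by (simp add: nn_adj_def)
  qed
  then obtain c where c: "x $ c \<noteq> y $ c" by blast
  have 1: "\<bar>x $ c - y $ c\<bar> + (\<Sum>i\<in>UNIV - {c}. \<bar>x $ i - y $ i\<bar>) = 1"
    using adj l1_dist_remove[of x y c] by (simp add: nn_adj_def l1_dist_def)
  have ge: "(\<Sum>i\<in>UNIV - {c}. \<bar>x $ i - y $ i\<bar>) \<ge> 0" by (intro sum_nonneg) auto
  have "(\<Sum>i\<in>UNIV - {c}. \<bar>x $ i - y $ i\<bar>) = 0" using 1 ge c by linarith
  then have "\<forall>i\<in>UNIV - {c}. \<bar>x $ i - y $ i\<bar> = 0"
    by (subst (asm) sum_nonneg_eq_0_iff) auto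
  then show "\<exists>c. \<bar>x $ c - y $ c\<bar> = 1 \<and> (\<forall>i. i \<noteq> c \<longrightarrow> x $ i = y $ i)"
    using 1 by (intro exI[of _ c]) auto
next
  assume "\<exists>c. \<bar>x $ c - y $ c\<bar> = 1 \<and> (\<forall>i. i \<noteq> c \<longrightarrow> x $ i = y $ i)"
  then obtain c where "\<bar>x $ c - y $ c\<bar> = 1" "\<forall>i. i \<noteq> c \<longrightarrow> x $ i = y $ i" by blast
  then show "nn_adj x y"
    using l1_dist_remove[of x y c] by (simp add: nn_adj_def l1_dist_def)
qed

lemma nn_adj_sym: "nn_adj x y \<longleftrightarrow> nn_adj y x"
  by (simp add: nn_adj_def abs_minus_commute)

lemma box_edges_iff:
  "{x, y} \<in> box_edges n \<longleftrightarrow> x \<in> lattice_box n \<and> y \<in> lattice_box n \<and> nn_adj x y"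
  unfolding box_edges_def using nn_adj_sym by (auto simp: doubleton_eq_iff)

text \<open>The distance from \<open>x\<close> is a potential that grows by at most one along an
  edge.\<close>

lemma walk_length_ge:
  assumes "is_walk (box_edges n) x y p"
  shows "l1_dist x y \<le> edge_sum (\<lambda>_. 1) p"
proof -
  have "real_of_int (l1_dist x (last p)) - l1_dist x (hd p) \<le> edge_sum (\<lambda>_. 1) p"
  proof (rule edge_sum_potential)
    fix u u' assume "{u, u'} \<in> set (path_edges p)"
    then have "{u, u'} \<in> box_edges n" using assms by (auto simp: is_walk_def)
    then have "l1_dist u u' = 1" by (simp add: box_edges_iff nn_adj_def l1_dist_def)
    moreover have "l1_dist x u' \<le> l1_dist x u + l1_dist u u'"
      unfolding l1_dist_def sum.distrib[symmetric] by (intro sum_mono) auto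
    ultimately show "real_of_int (l1_dist x u') - l1_dist x u \<le> 1" by linarith
  qed (use assms in \<open>simp add: is_walk_def\<close>)
  then show ?thesis using assms by (simp add: is_walk_def l1_dist_def)
qed

lemma finite_lattice_box: "finite (lattice_box n :: (int ^ 'd) set)"
proof -
  have "lattice_box n \<subseteq> vec_lambda ` ((UNIV :: 'd set) \<rightarrow>\<^sub>E {- 2 * int n .. 2 * int n})"
  proof
    fix z :: "int ^ 'd" assume "z \<in> lattice_box n"
    then have "z = vec_lambda (vec_nth z)" "vec_nth z \<in> UNIV \<rightarrow>\<^sub>E {- 2 * int n .. 2 * int n}"
      by (auto simp: lattice_box_def)
    then show "z \<in> vec_lambda ` ((UNIV :: 'd set) \<rightarrow>\<^sub>E {- 2 * int n .. 2 * int n})"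
      by (rule image_eqI)
  qed
  then show ?thesis by (rule finite_subset) (intro finite_imageI finite_PiE, auto)
qed

lemma Union_box_edges: "\<Union>(box_edges n) \<subseteq> lattice_box n"
  by (auto simp: box_edges_def)

text \<open>Moving one coordinate at a time towards \<open>y\<close> never leaves the cell.
  Restricting the cost hypothesis to the cell later confines walks to a hyperplane.\<close>

lemma monotone_walk:
  fixes x y :: "int ^ 'd"
  assumes "x \<in> lattice_box n" "y \<in> lattice_box n"
    and "\<And>u u'. nn_adj u u' \<Longrightarrow> u \<in> cell x y \<Longrightarrow> u' \<in> cell x y \<Longrightarrow>
       u \<in> lattice_box n \<Longrightarrow> u' \<in> lattice_box n \<Longrightarrow> w {u, u'} \<le> c"
  shows "\<exists>p. is_walk (box_edges n) x y p \<and> edge_sum w p \<le> c * l1_dist x y"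
  using assms
proof (induction "nat (l1_dist x y)" arbitrary: x rule: less_induct)
  case less
  show ?case
  proof (cases "x = y")
    case True
    then show ?thesis
      by (intro exI[of _ "[x]"]) (auto simp: is_walk_def l1_dist_def)
  next
    case False
    then obtain d where d: "x $ d \<noteq> y $ d" by (auto simp: vec_eq_iff)
    define x' where "x' = (\<chi> i. if i = d then x $ d + sgn (y $ d - x $ d) else x $ i)"
    have x'd: "x' $ d = x $ d + sgn (y $ d - x $ d)" and x'i: "\<And>i. i \<noteq> d \<Longrightarrow> x' $ i = x $ i"
      by (auto simp: x'_def)
    have adj: "nn_adj x x'"
      unfolding nn_adj_iff using d by (intro exI[of _ d]) (auto simp: x'd x'i sgn_if)
    have "(\<Sum>i\<in>UNIV - {d}. \<bar>x $ i - y $ i\<bar>) = (\<Sum>i\<in>UNIV - {d}. \<bar>x' $ i - y $ i\<bar>)"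
      by (intro sum.cong) (auto simp: x'i)
    then have dist: "l1_dist x y = l1_dist x' y + 1"
      using d by (simp add: l1_dist_remove[of _ _ d] x'd sgn_if)
    have pos: "l1_dist x' y \<ge> 0" by (auto simp: l1_dist_def intro: sum_nonneg)
    have cell_x': "z \<in> cell x y" if "z \<in> cell x' y" for z
      unfolding cell_def
    proof (safe)
      fix i
      have "min (x' $ i) (y $ i) \<le> z $ i" "z $ i \<le> max (x' $ i) (y $ i)"
        using that by (auto simp: cell_def)
      then show "min (x $ i) (y $ i) \<le> z $ i" "z $ i \<le> max (x $ i) (y $ i)"
        using d x'd x'i[of i] by (cases "i = d"; auto simp: sgn_if min_def max_def split: if_splits)+
    qed
    have xx': "x \<in> cell x y" "x' \<in> cell x' y" by (auto simp: cell_def)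
    have box: "x' \<in> lattice_box n"
      unfolding lattice_box_def
    proof safe
      fix i
      have "min (x $ i) (y $ i) \<le> x' $ i" "x' $ i \<le> max (x $ i) (y $ i)"
        using cell_x'[OF xx'(2)] by (auto simp: cell_def)
      moreover have "x $ i \<in> {- 2 * int n .. 2 * int n}" "y $ i \<in> {- 2 * int n .. 2 * int n}"
        using less.prems(1,2) unfolding lattice_box_def by blast+
      ultimately show "x' $ i \<in> {- 2 * int n .. 2 * int n}" by auto
    qed
    have "nat (l1_dist x' y) < nat (l1_dist x y)" using dist pos by linarith
    from less.hyps[OF this box less.prems(2)] less.prems(3) cell_x'
    obtain p where p: "is_walk (box_edges n) x' y p" "edge_sum w p \<le> c * l1_dist x' y"
      by blast
    obtain p' where p': "p = x' # p'" using p(1) by (cases p) (auto simp: is_walk_def)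
    have "is_walk (box_edges n) x y (x # p)"
      using p(1) adj box less.prems(1) by (simp add: is_walk_def p' box_edges_iff)
    moreover have "w {x, x'} \<le> c"
      using less.prems(1) less.prems(3)[OF adj xx'(1) cell_x'[OF xx'(2)] _ box] by simp
    then have "edge_sum w (x # p) \<le> c * l1_dist x y"
      using p(2) by (simp add: p' dist algebra_simps)
    ultimately show ?thesis by blast
  qed
qed

lemma zero_in_lattice_box [simp]: "0 \<in> lattice_box n"
  by (simp add: lattice_box_def)

lemma finite_graph_box:
  assumes "x \<in> lattice_box n" "y \<in> lattice_box n"
  shows "finite_graph (box_edges n) x y"
proof
  show "finite (\<Union>(box_edges n :: (int ^ 'a) set set))"
    using Union_box_edges finite_lattice_box by (rule finite_subset)
  show "\<exists>p. is_walk (box_edges n) x y p"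
    using monotone_walk[OF assms, of "\<lambda>_. 0" 0] by auto
qed

lemma passage_time_eq_min_time:
  "passage_time v n = min_time (box_edges n) 0 (int n *s v)"
proof -
  have "set p \<subseteq> lattice_box n" if "is_walk (box_edges n) 0 y p" for p and y :: "int ^ 'a"
  proof -
    \<comment> \<open>Inserting \<open>0\<close> accounts for the one-vertex walk, which has no
      edges.\<close>
    have "insert 0 (\<Union>(box_edges n)) \<subseteq> (lattice_box n :: (int ^ 'a) set)"
      using Union_box_edges by simp
    with walk_vertices[OF that] show ?thesis by (rule order_trans)
  qed
  then have "p \<in> box_paths n 0 y \<longleftrightarrow> is_walk (box_edges n) 0 y p \<and> distinct p"
    for p and y :: "int ^ 'a"
    unfolding box_paths_def is_walk_def mem_Collect_eq by meson
  then have "box_paths n 0 y = {p. is_walk (box_edges n) 0 y p \<and> distinct p}" for y :: "int ^ 'a"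
    by (intro set_eqI) simp
  then show ?thesis
    by (simp add: fun_eq_iff passage_time_def min_time_def edge_sum_def path_time_def)
qed

section \<open>Environments with two competing rows\<close>

text \<open>
  The rows run in direction \<open>i\<close> at height one in the directions \<open>c True\<close> and \<open>c False\<close>, which point
  away from the target, so both rows cost exactly two extra steps. Edges are cheap along the two
  rows, before level \<open>0\<close> and beyond level \<open>L\<close>, the level of the target, except that \<open>M r\<close> lists
  the expensive edges of row \<open>r\<close>.
\<close>

locale two_rows =
  fixes v :: "int ^ 'd" and n L :: nat and i :: 'd and c :: "bool \<Rightarrow> 'd"
    and \<theta> :: int and \<epsilon> :: "bool \<Rightarrow> int" and a b :: real
  assumes c_neq_i: "c r \<noteq> i" and c_inj: "c True \<noteq> c False"
    and \<theta>: "\<theta> = 1 \<or> \<theta> = - 1" and L_eq: "int L = int n * (\<theta> * v $ i)"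
    and \<epsilon>: "\<epsilon> r = 1 \<or> \<epsilon> r = - 1" and \<epsilon>_away: "\<epsilon> r * v $ c r \<le> 0"
    and target_in_box: "int n *s v \<in> lattice_box n" and n_pos: "0 < n"
    and a_pos: "0 < a" and a_less_b: "a < b"
    and L_ge: "4 \<le> L" and L_large: "2 * a + 2 * (b - a) \<le> (b - a) * real L"
begin

abbreviation target :: "int ^ 'd" where "target \<equiv> int n *s v"

text \<open>Progress towards the target: \<open>\<theta>\<close> orients the axis \<open>i\<close>
  so that the target has level \<open>L\<close>.\<close>

definition level :: "int ^ 'd \<Rightarrow> int" where "level x = \<theta> * x $ i"

definition offset :: "bool \<Rightarrow> 'd \<Rightarrow> int" where "offset r d = (if d = c r then \<epsilon> r else 0)"

definition row :: "bool \<Rightarrow> (int ^ 'd) set" where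
  "row r = {x. \<forall>d. d \<noteq> i \<longrightarrow> x $ d = offset r d}"

definition row_vertex :: "bool \<Rightarrow> nat \<Rightarrow> int ^ 'd" where
  "row_vertex r s = (\<chi> d. if d = i then \<theta> * int s else offset r d)"

definition row_edge :: "bool \<Rightarrow> nat \<Rightarrow> (int ^ 'd) set" where
  "row_edge r t = {row_vertex r t, row_vertex r (Suc t)}"

definition cheap :: "(int ^ 'd) set \<Rightarrow> bool" where
  "cheap e \<longleftrightarrow> (\<forall>x\<in>e. level x \<le> 0) \<or> (\<forall>x\<in>e. int L \<le> level x) \<or> (\<exists>r. e \<subseteq> row r)"

text \<open>The value \<open>undefined\<close> off the box is what the extensional function space in
  \<open>environments\<close> demands.\<close>

definition env :: "(bool \<Rightarrow> nat set) \<Rightarrow> 'd env" where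
  "env M e = (if e \<notin> box_edges n then undefined
     else if cheap e \<and> (\<forall>r. \<forall>t\<in>M r. e \<noteq> row_edge r t) then a else b)"

lemma c_eq_iff: "c r = c r' \<longleftrightarrow> r = r'"
  using c_inj by (cases r; cases r') auto

lemma \<epsilon>_nonzero: "\<epsilon> r \<noteq> 0"
  using \<epsilon>[of r] by auto

lemma \<theta>_sq: "\<theta> * (\<theta> * z) = z"
  using \<theta> by auto

lemma level_row_vertex [simp]: "level (row_vertex r s) = int s"
  by (simp add: level_def row_vertex_def \<theta>_sq)

lemma row_vertex_in_row [simp]: "row_vertex r s \<in> row r"
  by (simp add: row_def row_vertex_def)

lemma row_unique:
  assumes "x \<in> row r" "x \<in> row r'"
  shows "r = r'"
proof (rule ccontr)
  assume "r \<noteq> r'"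
  then have "c r \<noteq> c r'" by (simp add: c_eq_iff)
  moreover have "x $ c r = offset r (c r)" "x $ c r = offset r' (c r)"
    using assms c_neq_i by (auto simp: row_def)
  ultimately show False using \<epsilon>_nonzero[of r] by (simp add: offset_def)
qed

lemma row_vertex_level:
  assumes "x \<in> row r" "0 \<le> level x"
  shows "x = row_vertex r (nat (level x))"
proof -
  have "\<theta> * int (nat (level x)) = x $ i" using assms(2) by (simp add: level_def \<theta>_sq)
  then show ?thesis using assms(1) by (auto simp: vec_eq_iff row_vertex_def row_def)
qed

lemma row_vertex_inject [simp]: "row_vertex r s = row_vertex r' s' \<longleftrightarrow> r = r' \<and> s = s'"
proof
  assume eq: "row_vertex r s = row_vertex r' s'"
  have "s = s'" using arg_cong[OF eq, of level] by simp
  moreover have "row_vertex r s \<in> row r'" unfolding eq by simp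
  then have "r = r'" using row_unique[OF row_vertex_in_row] by blast
  ultimately show "r = r' \<and> s = s'" by simp
qed auto

lemma row_edge_inject [simp]: "row_edge r t = row_edge r' t' \<longleftrightarrow> r = r' \<and> t = t'"
  by (auto simp: row_edge_def doubleton_eq_iff)

lemma L_le: "int L \<le> 2 * int n"
proof -
  have "int n * v $ i \<in> {- 2 * int n .. 2 * int n}"
    using target_in_box by (simp add: lattice_box_def)
  then show ?thesis using \<theta> unfolding L_eq by auto
qed

lemma row_vertex_in_box: "s \<le> L \<Longrightarrow> row_vertex r s \<in> lattice_box n"
  using L_le n_pos \<theta> \<epsilon>[of r] by (auto simp: lattice_box_def row_vertex_def offset_def)

lemma row_vertex_adj: "nn_adj (row_vertex r s) (row_vertex r (Suc s))"
  unfolding nn_adj_iff using \<theta>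
  by (intro exI[of _ i]) (auto simp: row_vertex_def algebra_simps)

lemma row_edge_in_box: "t < L \<Longrightarrow> row_edge r t \<in> box_edges n"
  by (simp add: row_edge_def box_edges_iff row_vertex_in_box row_vertex_adj)

lemma cheap_row_edge: "cheap (row_edge r t)"
  unfolding cheap_def row_edge_def by (intro disjI2 exI[of _ r]) simp

lemma env_in_environments: "env M \<in> environments a b n"
  by (auto simp: environments_def env_def)

lemma env_nonneg: "e \<in> box_edges n \<Longrightarrow> 0 \<le> env M e"
  using a_pos a_less_b by (simp add: env_def)

text \<open>Differentiating along row edges stays within the family \<open>env\<close>. The bound
  \<open>t < L\<close> keeps the edge inside the box.\<close>

lemma set_coord_env:
  assumes "t < L"
  shows "set_coord (row_edge r t) b (env M) = env (M(r := insert t (M r)))"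
    "set_coord (row_edge r t) a (env M) = env (M(r := M r - {t}))"
proof -
  have "set_coord (row_edge r t) x (env M) = env (M(r := N))"
    if N: "N - {t} = M r - {t}" and x: "x = (if t \<in> N then b else a)" for N x
  proof
    fix e
    show "set_coord (row_edge r t) x (env M) e = env (M(r := N)) e"
    proof (cases "e = row_edge r t")
      case True
      have "(\<forall>r'. \<forall>t'\<in>(M(r := N)) r'. e \<noteq> row_edge r' t') \<longleftrightarrow> t \<notin> N"
        unfolding True row_edge_inject by auto
      then show ?thesis
        using assms True by (simp add: x set_coord_def env_def cheap_row_edge row_edge_in_box)
    next
      case False
      then have "t' \<in> (M(r := N)) r' \<and> e = row_edge r' t' \<longleftrightarrow> t' \<in> M r' \<and> e = row_edge r' t'" for r' t'
        using N by (cases "r' = r") auto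
      then have "(\<forall>r'. \<forall>t'\<in>(M(r := N)) r'. e \<noteq> row_edge r' t') \<longleftrightarrow>
          (\<forall>r'. \<forall>t'\<in>M r'. e \<noteq> row_edge r' t')"
        by metis
      then show ?thesis
        using False unfolding env_def set_coord_def by simp
    qed
  qed
  from this[of "insert t (M r)" b] this[of "M r - {t}" a]
  show "set_coord (row_edge r t) b (env M) = env (M(r := insert t (M r)))"
    "set_coord (row_edge r t) a (env M) = env (M(r := M r - {t}))"
    by auto
qed

lemma level_target: "level target = int L"
  by (simp add: level_def L_eq)

lemma l1_dist_remove2:
  fixes x y :: "int ^ 'd"
  shows "l1_dist x y = \<bar>x $ i - y $ i\<bar> + \<bar>x $ c r - y $ c r\<bar> +
     (\<Sum>d\<in>UNIV - {i} - {c r}. \<bar>x $ d - y $ d\<bar>)"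
proof -
  have "(\<Sum>d\<in>UNIV - {i}. \<bar>x $ d - y $ d\<bar>) =
      \<bar>x $ c r - y $ c r\<bar> + (\<Sum>d\<in>UNIV - {i} - {c r}. \<bar>x $ d - y $ d\<bar>)"
    using c_neq_i by (intro sum.remove) auto
  then show ?thesis by (simp add: l1_dist_remove[of x y i])
qed

text \<open>Because \<open>\<epsilon> r\<close> points away from the target, the unit offset of a
  row adds one to the distance from either end. A path through a row thus exceeds
  \<open>l1_dist 0 target\<close> by at least two.\<close>

lemma l1_dist_row:
  assumes "x \<in> row r"
  shows "l1_dist 0 x = \<bar>level x\<bar> + 1"
    "l1_dist x target = \<bar>int L - level x\<bar> + 1 + l1_dist 0 target - int L"
proof -
  have xc: "x $ c r = \<epsilon> r" and x0: "\<And>d. d \<noteq> i \<Longrightarrow> d \<noteq> c r \<Longrightarrow> x $ d = 0"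
    using assms c_neq_i by (auto simp: row_def offset_def)
  have abs_\<theta>: "\<bar>z\<bar> = \<bar>\<theta> * z\<bar>" for z using \<theta> by auto
  have "(\<Sum>d\<in>UNIV - {i} - {c r}. \<bar>0 - x $ d\<bar>) = 0"
    by (intro sum.neutral) (auto simp: x0)
  then show "l1_dist 0 x = \<bar>level x\<bar> + 1"
    using \<epsilon>[of r] abs_\<theta>[of "x $ i"] by (auto simp: l1_dist_remove2[of _ _ r] xc level_def)
  have "int n * (\<epsilon> r * v $ c r) \<le> 0"
    by (rule mult_nonneg_nonpos[OF of_nat_0_le_iff \<epsilon>_away])
  then have "\<bar>\<epsilon> r - z\<bar> = 1 + \<bar>z\<bar>" if "z = int n * v $ c r" for z
    unfolding mult.left_commute[of "int n"] using \<epsilon>[of r] by (auto simp flip: that)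
  from this[OF refl]
  have "\<bar>\<epsilon> r - int n * v $ c r\<bar> = 1 + \<bar>int n * v $ c r\<bar>" .
  moreover have "(\<Sum>d\<in>UNIV - {i} - {c r}. \<bar>x $ d - target $ d\<bar>) =
      (\<Sum>d\<in>UNIV - {i} - {c r}. \<bar>0 $ d - target $ d\<bar>)"
    by (intro sum.cong) (auto simp: x0)
  moreover have "\<bar>x $ i - int n * v $ i\<bar> = \<bar>int L - level x\<bar>"
    using abs_\<theta>[of "x $ i - int n * v $ i"] by (simp add: level_def L_eq algebra_simps abs_minus_commute)
  moreover have "\<bar>int n * v $ i\<bar> = int L"
    using abs_\<theta>[of "int n * v $ i"] L_eq by (simp add: mult.left_commute)
  ultimately show "l1_dist x target = \<bar>int L - level x\<bar> + 1 + l1_dist 0 target - int L"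
    by (simp add: l1_dist_remove2[of _ _ r] xc)
qed

section \<open>Upper bound for the passage time\<close>

lemma env_cheap_le:
  assumes "{u, u'} \<in> box_edges n" "level u = s" "level u' = s" "s = 0 \<or> s = int L"
  shows "env M {u, u'} \<le> a"
proof -
  \<comment> \<open>A row edge joins two different levels, so no choice of \<open>M\<close> makes
    this edge expensive.\<close>
  have "{u, u'} \<noteq> row_edge r t" for r t
  proof
    assume "{u, u'} = row_edge r t"
    then have "level ` {u, u'} = level ` row_edge r t" by simp
    then show False using assms by (auto simp: row_edge_def)
  qed
  moreover have "cheap {u, u'}" using assms by (auto simp: cheap_def)
  ultimately show ?thesis using assms(1) by (simp add: env_def)
qed

lemma level_walk:
  assumes "x \<in> lattice_box n" "y \<in> lattice_box n" "level x = s" "level y = s" "s = 0 \<or> s = int L"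
  shows "\<exists>p. is_walk (box_edges n) x y p \<and> edge_sum (env M) p \<le> a * l1_dist x y"
proof (rule monotone_walk[OF assms(1,2)])
  fix u u' :: "int ^ 'd"
  assume u: "nn_adj u u'" "u \<in> cell x y" "u' \<in> cell x y" "u \<in> lattice_box n" "u' \<in> lattice_box n"
  have xy: "x $ i = \<theta> * s" "y $ i = \<theta> * s"
    using assms(3,4) \<theta>_sq by (metis level_def)+
  have "z $ i = \<theta> * s" if "z \<in> cell x y" for z
  proof -
    have "min (x $ i) (y $ i) \<le> z $ i" "z $ i \<le> max (x $ i) (y $ i)"
      using that unfolding cell_def by blast+
    then show ?thesis unfolding xy by simp
  qed
  then have "level u = s" "level u' = s"
    using u by (simp_all add: level_def \<theta>_sq)
  then show "env M {u, u'} \<le> a"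
    using u assms(5) by (intro env_cheap_le) (auto simp: box_edges_iff)
qed

lemma row_walk:
  assumes "s \<le> L"
  shows "\<exists>p. is_walk (box_edges n) (row_vertex r 0) (row_vertex r s) p \<and>
    edge_sum (env M) p \<le> a * s + (b - a) * card (M r \<inter> {..<s})"
  using assms
proof (induction s)
  case 0
  show ?case by (intro exI[of _ "[row_vertex r 0]"]) (simp add: is_walk_def)
next
  case (Suc s)
  then obtain p where p: "is_walk (box_edges n) (row_vertex r 0) (row_vertex r s) p"
    "edge_sum (env M) p \<le> a * s + (b - a) * card (M r \<inter> {..<s})" by auto
  let ?q = "[row_vertex r s, row_vertex r (Suc s)]"
  have q: "is_walk (box_edges n) (row_vertex r s) (row_vertex r (Suc s)) ?q"
    using row_edge_in_box[of s r] Suc.prems by (simp add: is_walk_def row_edge_def)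
  have "(\<forall>r'. \<forall>t'\<in>M r'. row_edge r s \<noteq> row_edge r' t') \<longleftrightarrow> s \<notin> M r"
    unfolding row_edge_inject by (cases r) (auto simp: all_bool_eq)
  then have "env M (row_edge r s) = (if s \<in> M r then b else a)"
    using Suc.prems unfolding env_def by (simp add: cheap_row_edge row_edge_in_box)
  then have "edge_sum (env M) ?q = a + (b - a) * of_bool (s \<in> M r)"
    by (simp add: row_edge_def)
  moreover have "M r \<inter> {..<Suc s} = (if s \<in> M r then insert s (M r \<inter> {..<s}) else M r \<inter> {..<s})"
    by (auto simp: less_Suc_eq)
  then have "real (card (M r \<inter> {..<Suc s})) = card (M r \<inter> {..<s}) + of_bool (s \<in> M r)"
    by simp
  ultimately have "edge_sum (env M) (p @ tl ?q) \<le> a * Suc s + (b - a) * card (M r \<inter> {..<Suc s})"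
    using p(2) is_walk_join(2)[OF p(1) q, of "env M"] by (simp add: algebra_simps)
  with is_walk_join(1)[OF p(1) q] show ?case by blast
qed

text \<open>The walk reaches the row within level \<open>0\<close>, follows it to level
  \<open>L\<close> and finishes within level \<open>L\<close>, with just two steps of excess
  length.\<close>

lemma passage_le:
  assumes "M r \<subseteq> {..<L}"
  shows "passage_time v n (env M) \<le> a * (l1_dist 0 target + 2) + (b - a) * card (M r)"
proof -
  interpret finite_graph "box_edges n" 0 target
    by (rule finite_graph_box) (simp_all add: target_in_box)
  have box: "row_vertex r 0 \<in> lattice_box n" "row_vertex r L \<in> lattice_box n"
    by (simp_all add: row_vertex_in_box)
  have "\<exists>p. is_walk (box_edges n) 0 (row_vertex r 0) p \<and>
      edge_sum (env M) p \<le> a * l1_dist 0 (row_vertex r 0)"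
    by (rule level_walk[where s = 0]) (simp_all add: box, simp add: level_def)
  then obtain p1 where p1: "is_walk (box_edges n) 0 (row_vertex r 0) p1" "edge_sum (env M) p1 \<le> a"
    using l1_dist_row(1)[OF row_vertex_in_row, of r 0] by auto
  obtain p2 where p2: "is_walk (box_edges n) (row_vertex r 0) (row_vertex r L) p2"
      "edge_sum (env M) p2 \<le> a * L + (b - a) * card (M r)"
    using row_walk[of L r M] assms by (auto simp: Int_absorb2)
  have "\<exists>p. is_walk (box_edges n) (row_vertex r L) target p \<and>
      edge_sum (env M) p \<le> a * l1_dist (row_vertex r L) target"
    by (rule level_walk[where s = "int L"]) (simp_all add: box target_in_box level_target)
  then obtain p3 where p3: "is_walk (box_edges n) (row_vertex r L) target p3"
      "edge_sum (env M) p3 \<le> a * (1 + l1_dist 0 target - int L)"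
    using l1_dist_row(2)[OF row_vertex_in_row, of r L] by auto
  note 12 = is_walk_join[OF p1(1) p2(1)]
  note 123 = is_walk_join[OF 12(1) p3(1)]
  have "passage_time v n (env M) \<le> edge_sum (env M) ((p1 @ tl p2) @ tl p3)"
    unfolding passage_time_eq_min_time using 123(1) env_nonneg by (intro min_time_le) auto
  also have "\<dots> \<le> a * (l1_dist 0 target + 2) + (b - a) * card (M r)"
    unfolding 123(2) 12(2) using p1(2) p2(2) p3(2) by (simp add: algebra_simps)
  finally show ?thesis .
qed

section \<open>Lower bound for the passage time\<close>

lemma adj_cases:
  assumes "nn_adj x y"
  obtains "\<bar>level x - level y\<bar> = 1" "\<And>r. x \<in> row r \<longleftrightarrow> y \<in> row r"
  | "level x = level y" "\<And>r r'. x \<in> row r \<Longrightarrow> y \<in> row r' \<Longrightarrow> False"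
proof -
  obtain d where d: "\<bar>x $ d - y $ d\<bar> = 1" "\<And>j. j \<noteq> d \<Longrightarrow> x $ j = y $ j"
    using assms unfolding nn_adj_iff by blast
  show thesis
  proof (cases "d = i")
    case True
    show thesis
    proof (rule that(1))
      show "\<bar>level x - level y\<bar> = 1" using d(1) \<theta> True by (auto simp: level_def)
      show "x \<in> row r \<longleftrightarrow> y \<in> row r" for r using d(2) True by (auto simp: row_def)
    qed
  next
    case False
    show thesis
    proof (rule that(2))
      show "level x = level y" using d(2) False by (simp add: level_def)
      fix r r' assume r: "x \<in> row r" "y \<in> row r'"
      show False
      proof (cases "r = r'")
        case True
        then show False using r d(1) False by (auto simp: row_def)
      next
        case neq: False
        \<comment> \<open>Vertices of different rows differ in two coordinates, hence are not
          adjacent.\<close>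
        then have "c r \<noteq> c r'" by (simp add: c_eq_iff)
        moreover have "x $ j \<noteq> y $ j" if "j \<in> {c r, c r'}" for j
          using that r c_neq_i \<epsilon>_nonzero \<open>c r \<noteq> c r'\<close> by (auto simp: row_def offset_def)
        ultimately show False using d(2) by (metis insertCI)
      qed
    qed
  qed
qed

text \<open>Separates the length of a path from its number of expensive edges; the two are then
  bounded independently.\<close>

lemma edge_sum_env:
  assumes "set (path_edges p) \<subseteq> box_edges n"
  shows "edge_sum (env M) p =
    a * edge_sum (\<lambda>_. 1) p + (b - a) * edge_sum (\<lambda>e. of_bool (env M e = b)) p"
proof -
  have "edge_sum (env M) p = edge_sum (\<lambda>e. a * 1 + (b - a) * of_bool (env M e = b)) p"
    unfolding edge_sum_def using assms a_less_b
    by (intro arg_cong[where f = sum_list] map_cong) (auto simp: env_def)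
  then show ?thesis
    by (simp only: edge_sum_def sum_list_addf sum_list_const_mult)
qed

text \<open>Row edge \<open>t\<close> joins the levels \<open>t\<close> and \<open>t + 1\<close>, so
  the edges passed on reaching level \<open>s\<close> are those with \<open>t < s\<close>.\<close>

definition count_below :: "(bool \<Rightarrow> nat set) \<Rightarrow> nat \<Rightarrow> bool \<Rightarrow> int \<Rightarrow> int" where
  "count_below M m r s = min (int m) (int (card {t \<in> M r. int t < s}))"

text \<open>
  A lower bound, truncated at \<open>m\<close>, for the number of expensive edges on a path from the origin.
  The value \<open>min 1 m\<close> off the rows is within \<open>1\<close> of all of \<open>{0..m}\<close> because \<open>m \<le> 2\<close>.
\<close>

definition toll :: "(bool \<Rightarrow> nat set) \<Rightarrow> nat \<Rightarrow> int ^ 'd \<Rightarrow> int" where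
  "toll M m x =
     (if x \<in> row True then count_below M m True (level x)
      else if x \<in> row False then count_below M m False (level x)
      else if level x \<le> 0 then 0 else if int L \<le> level x then int m else min 1 (int m))"

context
  fixes M :: "bool \<Rightarrow> nat set" and m :: nat
  assumes M: "M r \<subseteq> {..<L}" and m_le_card: "m \<le> card (M r)" and m_le_2: "m \<le> 2"
begin

lemma finite_M: "finite (M r)"
  using M finite_subset by blast

lemma count_below_nonpos: "s \<le> 0 \<Longrightarrow> count_below M m r s = 0"
  by (simp add: count_below_def)

lemma count_below_ge_L:
  assumes "int L \<le> s"
  shows "count_below M m r s = int m"
proof -
  have "{t \<in> M r. int t < s} = M r" using M[of r] assms by auto
  then show ?thesis using m_le_card[of r] by (simp add: count_below_def)
qed

lemma count_below_step:
  "\<bar>count_below M m r s - count_below M m r (s + 1)\<bar> \<le> of_bool (0 \<le> s \<and> nat s \<in> M r)"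
proof -
  have "{t \<in> M r. int t < s + 1} =
      (if 0 \<le> s \<and> nat s \<in> M r then insert (nat s) {t \<in> M r. int t < s} else {t \<in> M r. int t < s})"
    by (auto simp: zless_add1_eq) (metis nat_int order_le_less)
  then have "int (card {t \<in> M r. int t < s + 1}) =
      int (card {t \<in> M r. int t < s}) + of_bool (0 \<le> s \<and> nat s \<in> M r)"
    using finite_M[of r] by simp
  then show ?thesis by (auto simp: count_below_def)
qed

lemma toll_row: "x \<in> row r \<Longrightarrow> toll M m x = count_below M m r (level x)"
  using row_unique[of x True False] by (cases r) (auto simp: toll_def)

lemma toll_range: "0 \<le> toll M m x" "toll M m x \<le> int m"
  by (auto simp: toll_def count_below_def)

lemma toll_low: "level x \<le> 0 \<Longrightarrow> toll M m x = 0"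
  by (simp add: toll_def count_below_nonpos)

lemma toll_high: "int L \<le> level x \<Longrightarrow> toll M m x = int m"
  using L_ge by (simp add: toll_def count_below_ge_L)

lemma toll_row_step:
  assumes "x \<in> row r" "y \<in> row r" "level y = level x + 1" "{x, y} \<in> box_edges n"
  shows "\<bar>toll M m x - toll M m y\<bar> \<le> of_bool (env M {x, y} = b)"
proof (cases "0 \<le> level x \<and> nat (level x) \<in> M r")
  case True
  have "x = row_vertex r (nat (level x))" "y = row_vertex r (nat (level y))"
    by (rule row_vertex_level; use assms True in simp)+
  moreover have "nat (level y) = Suc (nat (level x))" using assms(3) True by linarith
  ultimately have "{x, y} = row_edge r (nat (level x))" by (simp add: row_edge_def)
  then have "env M {x, y} = b" using assms(4) True unfolding env_def by metis
  then show ?thesis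
    using count_below_step[of r "level x"] True assms by (simp add: toll_row)
next
  case False
  then have "count_below M m r (level x) = count_below M m r (level x + 1)"
    using count_below_step[of r "level x"] by (auto simp: of_bool_def split: if_splits)
  then show ?thesis using assms by (simp add: toll_row)
qed

text \<open>The toll is constant in the two cheap end regions, and along a row it changes only at
  edges of \<open>M\<close>. On any remaining edge, one end is off the rows and strictly between the
  end levels; its middle value is within one of every toll.\<close>

lemma toll_step:
  assumes "{x, y} \<in> box_edges n"
  shows "\<bar>toll M m x - toll M m y\<bar> \<le> of_bool (env M {x, y} = b)"
proof -
  have adj: "nn_adj x y" using assms by (simp add: box_edges_iff)
  consider (low) "level x \<le> 0" "level y \<le> 0" | (high) "int L \<le> level x" "int L \<le> level y"
    | (row) r where "x \<in> row r" "y \<in> row r" | (exp) "\<not> cheap {x, y}"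
    unfolding cheap_def by auto
  then show ?thesis
  proof cases
    case low
    then show ?thesis by (simp add: toll_low)
  next
    case high
    then show ?thesis by (simp add: toll_high)
  next
    case row
    from adj have "level y = level x + 1 \<or> level x = level y + 1"
      by (rule adj_cases) (use row in auto)
    then show ?thesis
      using toll_row_step[of x r y] toll_row_step[of y r x] row assms
      by (auto simp: insert_commute abs_minus_commute)
  next
    case exp
    then have b: "env M {x, y} = b" using assms by (simp add: env_def)
    have plain: "toll M m z = min 1 (int m)" if "0 < level z" "level z < int L" "\<And>r. z \<notin> row r" for z
      using that by (simp add: toll_def)
    have not: "\<not> (level x \<le> 0 \<and> level y \<le> 0)" "\<not> (int L \<le> level x \<and> int L \<le> level y)"
      "\<And>r. \<not> (x \<in> row r \<and> y \<in> row r)"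
      using exp by (auto simp: cheap_def)
    from adj have "toll M m x = min 1 (int m) \<or> toll M m y = min 1 (int m)"
    proof (rule adj_cases)
      assume 1: "\<bar>level x - level y\<bar> = 1" "\<And>r. x \<in> row r \<longleftrightarrow> y \<in> row r"
      have "x \<notin> row r" "y \<notin> row r" for r using 1(2) not(3) by blast+
      moreover have "(0 < level x \<and> level x < int L) \<or> (0 < level y \<and> level y < int L)"
        using 1(1) not L_ge by linarith
      ultimately show ?thesis using plain by blast
    next
      assume 2: "level x = level y" "\<And>r r'. x \<in> row r \<Longrightarrow> y \<in> row r' \<Longrightarrow> False"
      have "0 < level x" "level x < int L" using 2(1) not by linarith+
      then show ?thesis using plain 2 by metis
    qed
    then show ?thesis using toll_range[of x] toll_range[of y] m_le_2 b by auto
  qed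
qed

text \<open>A path that meets a row has two steps of excess and pays the toll \<open>m\<close>. A
  path that meets none may save the excess, but climbs \<open>L\<close> levels on expensive edges,
  and \<open>L_large\<close> makes that no better.\<close>

lemma passage_ge:
  "a * (l1_dist 0 target + 2) + (b - a) * m \<le> passage_time v n (env M)"
proof -
  interpret finite_graph "box_edges n" 0 target
    by (rule finite_graph_box) (simp_all add: target_in_box)
  obtain p where p: "is_walk (box_edges n) 0 target p" and
    time: "passage_time v n (env M) = edge_sum (env M) p"
    using min_time_attained[of "env M"] by (auto simp: passage_time_eq_min_time)
  let ?len = "edge_sum (\<lambda>_. 1) p" and ?exp = "edge_sum (\<lambda>e. of_bool (env M e = b)) p"
  have p': "p \<noteq> []" "hd p = 0" "last p = target" "set (path_edges p) \<subseteq> box_edges n"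
    using p by (auto simp: is_walk_def)
  have level0: "level 0 = 0" by (simp add: level_def)
  have exp_ge: "real_of_int (h target) - h 0 \<le> ?exp"
    if "\<And>x y. {x, y} \<in> set (path_edges p) \<Longrightarrow> \<bar>h x - h y\<bar> \<le> of_bool (env M {x, y} = b)"
    for h :: "int ^ 'd \<Rightarrow> int"
  proof -
    have "real_of_int (h (last p)) - h (hd p) \<le> ?exp"
    proof (rule edge_sum_potential[OF p'(1)])
      fix x y assume "{x, y} \<in> set (path_edges p)"
      from that[OF this] show "real_of_int (h y) - h x \<le> of_bool (env M {x, y} = b)"
        by (auto simp: of_bool_def split: if_splits)
    qed
    then show ?thesis by (simp only: p')
  qed
  have "a * (l1_dist 0 target + 2) + (b - a) * m \<le> a * ?len + (b - a) * ?exp"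
  proof (cases "\<exists>x\<in>set p. \<exists>r. x \<in> row r")
    case True
    then obtain x r where x: "x \<in> set p" "x \<in> row r" by blast
    then obtain xs ys where p_eq: "p = xs @ x # ys" by (meson split_list)
    have "is_walk (box_edges n) 0 x (xs @ [x])" "is_walk (box_edges n) x target (x # ys)"
      using p' path_edges_append[of xs x ys]
      by (auto simp: is_walk_def p_eq hd_append split: if_splits)
    then have "l1_dist 0 x + l1_dist x target \<le> ?len"
      using walk_length_ge[of n 0 x "xs @ [x]"] walk_length_ge[of n x target "x # ys"]
        edge_sum_append[of "\<lambda>_. 1" xs x ys] by (simp add: p_eq)
    moreover have "l1_dist 0 target + 2 \<le> l1_dist 0 x + l1_dist x target"
      unfolding l1_dist_row[OF x(2)] by linarith
    ultimately have "a * (l1_dist 0 target + 2) \<le> a * ?len"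
      using a_pos by (intro mult_left_mono) linarith+
    moreover have "m \<le> ?exp"
      using exp_ge[of "toll M m"] toll_step p'(4) by (auto simp: toll_low toll_high level0 level_target)
    then have "(b - a) * m \<le> (b - a) * ?exp" using a_less_b by (intro mult_left_mono) auto
    ultimately show ?thesis by linarith
  next
    case False
    \<comment> \<open>Clipping makes the potential constant in the end regions, where edges off the
      rows can be cheap.\<close>
    define h where "h x = max 0 (min (int L) (level x))" for x
    have "\<bar>h x - h y\<bar> \<le> of_bool (env M {x, y} = b)" if xy: "{x, y} \<in> set (path_edges p)" for x y
    proof -
      have edge: "{x, y} \<in> box_edges n" using xy p'(4) by blast
      have no_row: "x \<notin> row r" for r
        using False path_edges_subset_vertices[OF xy] by blast
      have "nn_adj x y" using edge by (simp add: box_edges_iff)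
      then have "\<bar>level x - level y\<bar> \<le> 1" by (rule adj_cases) auto
      moreover have "env M {x, y} = b \<or> (level x \<le> 0 \<and> level y \<le> 0) \<or> (int L \<le> level x \<and> int L \<le> level y)"
        using edge no_row by (auto simp: env_def cheap_def)
      ultimately show ?thesis by (auto simp: h_def)
    qed
    from exp_ge[of h, OF this] have "L \<le> ?exp" by (simp add: h_def level_target level0)
    then have "(b - a) * L \<le> (b - a) * ?exp" using a_less_b by (intro mult_left_mono) auto
    moreover have "a * l1_dist 0 target \<le> a * ?len"
      using walk_length_ge[OF p] a_pos by (intro mult_left_mono) auto
    moreover have "(b - a) * m \<le> (b - a) * 2" using a_less_b m_le_2 by (intro mult_left_mono) auto
    moreover have "a * (l1_dist 0 target + 2) = a * l1_dist 0 target + 2 * a" by (simp add: algebra_simps)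
    ultimately show ?thesis using L_large by linarith
  qed
  then show ?thesis unfolding time edge_sum_env[OF p'(4)] by simp
qed

end

section \<open>Exact passage times and extremal derivatives\<close>

lemma passage_time_env:
  assumes "\<And>r. M r \<subseteq> {..<L}" "min (card (M True)) (card (M False)) \<le> 2"
  shows "passage_time v n (env M) =
    a * (l1_dist 0 target + 2) + (b - a) * min (card (M True)) (card (M False))"
proof (rule antisym)
  show "a * (l1_dist 0 target + 2) + (b - a) * min (card (M True)) (card (M False))
      \<le> passage_time v n (env M)"
  proof (rule passage_ge)
    show "min (card (M True)) (card (M False)) \<le> card (M r)" for r by (cases r) auto
  qed (use assms in auto)
  show "passage_time v n (env M) \<le>
      a * (l1_dist 0 target + 2) + (b - a) * min (card (M True)) (card (M False))"
    using passage_le[of M True] passage_le[of M False] assms(1) by (simp add: min_def)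
qed

definition env2 :: "nat set \<Rightarrow> nat set \<Rightarrow> 'd env" where
  "env2 I J = env (\<lambda>r. if r then I else J)"

lemma set_coord_env2:
  assumes "t < L"
  shows "set_coord (row_edge True t) b (env2 I J) = env2 (insert t I) J"
    "set_coord (row_edge True t) a (env2 I J) = env2 (I - {t}) J"
    "set_coord (row_edge False t) b (env2 I J) = env2 I (insert t J)"
    "set_coord (row_edge False t) a (env2 I J) = env2 I (J - {t})"
  unfolding env2_def set_coord_env[OF assms] by (rule arg_cong[where f = env]; auto simp: fun_eq_iff)+

lemma passage_time_env2:
  assumes "I \<subseteq> {..<L}" "J \<subseteq> {..<L}" "min (card I) (card J) \<le> 2"
  shows "passage_time v n (env2 I J) = a * (l1_dist 0 target + 2) + (b - a) * min (card I) (card J)"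
  using passage_time_env[of "\<lambda>r. if r then I else J"] assms by (auto simp: env2_def)

text \<open>\<open>A\<close> lists edges by row and position. Entries of \<open>I\<close> and
  \<open>J\<close> at these edges are overwritten; the others supply constants such as the
  \<open>1\<close> in \<open>min x\<^sub>1 1\<close>.\<close>

lemma deriv_values_row_edges:
  assumes "card A = k" "A \<subseteq> UNIV \<times> {..<L}"
  shows "edges_deriv a b ((\<lambda>(r, t). row_edge r t) ` A) (passage_time v n) (env2 I J)
    \<in> deriv_values v a b k"
proof -
  have "card ((\<lambda>(r, t). row_edge r t) ` A) = k"
    unfolding assms(1)[symmetric] by (intro card_image inj_onI) auto
  moreover have "(\<lambda>(r, t). row_edge r t) ` A \<subseteq> box_edges n"
    using assms(2) row_edge_in_box by auto
  ultimately show ?thesis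
    using env_in_environments unfolding env2_def deriv_values_def by blast
qed

text \<open>
  With \<open>x\<^sub>e\<close> indicating the expensive edges, the eight values come, in this order, from the
  functions \<open>min x\<^sub>1 1\<close>, \<open>min x\<^sub>1 0\<close>, \<open>min x\<^sub>1 x\<^sub>2\<close>, \<open>min (x\<^sub>1 + x\<^sub>2) 1\<close>, \<open>min (x\<^sub>1 + x\<^sub>2 + x\<^sub>3) 1\<close>,
  \<open>min x\<^sub>1 (x\<^sub>2 + x\<^sub>3)\<close>, \<open>min (x\<^sub>1 + x\<^sub>2 + x\<^sub>3 + x\<^sub>4) 2\<close> and \<open>min (x\<^sub>1 + x\<^sub>2 + x\<^sub>3) (x\<^sub>4 + 1)\<close>.
\<close>

lemma extremal_deriv_values:
  "b - a \<in> deriv_values v a b 1" "0 \<in> deriv_values v a b 1"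
  "b - a \<in> deriv_values v a b 2" "- (b - a) \<in> deriv_values v a b 2"
  "b - a \<in> deriv_values v a b 3" "- (b - a) \<in> deriv_values v a b 3"
  "2 * (b - a) \<in> deriv_values v a b 4" "- (2 * (b - a)) \<in> deriv_values v a b 4"
proof -
  have L: "0 < L" "Suc 0 < L" "2 < L" "3 < L" using L_ge by simp_all
  note compute = L edges_deriv_insert edges_deriv_empty edge_deriv_def set_coord_env2
    passage_time_env2 insert_Diff_if
  show "b - a \<in> deriv_values v a b 1"
    using deriv_values_row_edges[of "{(True, 0)}" 1 "{}" "{0}"] by (simp add: compute)
  show "0 \<in> deriv_values v a b 1"
    using deriv_values_row_edges[of "{(True, 0)}" 1 "{}" "{}"] by (simp add: compute)
  show "b - a \<in> deriv_values v a b 2"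
    using deriv_values_row_edges[of "{(True, 0), (False, 0)}" 2 "{}" "{}"]
    by (simp add: compute)
  show "- (b - a) \<in> deriv_values v a b 2"
    using deriv_values_row_edges[of "{(True, 0), (True, 1)}" 2 "{}" "{0}"]
    by (simp add: compute)
  show "b - a \<in> deriv_values v a b 3"
    using deriv_values_row_edges[of "{(True, 0), (True, 1), (True, 2)}" 3 "{}" "{0}"]
    by (simp add: compute)
  show "- (b - a) \<in> deriv_values v a b 3"
    using deriv_values_row_edges[of "{(True, 0), (False, 0), (False, 1)}" 3 "{}" "{}"]
    by (simp add: compute)
  \<comment> \<open>With \<open>s = x\<^sub>1 + x\<^sub>2 + x\<^sub>3\<close>, the third derivatives
    of \<open>min s 1\<close> and \<open>min s 2\<close> are 1 and -1. Fixing
    \<open>x\<^sub>4\<close> to 0 or 1 leaves these two functions up to a constant, in opposite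
    orders for the two values below.\<close>
  show "2 * (b - a) \<in> deriv_values v a b 4"
    using deriv_values_row_edges[of "{(True, 0), (True, 1), (True, 2), (True, 3)}" 4
        "{}" "{0, 1}"]
    by (simp add: compute algebra_simps)
  show "- (2 * (b - a)) \<in> deriv_values v a b 4"
    using deriv_values_row_edges[of "{(True, 0), (True, 1), (True, 2), (False, 0)}" 4
        "{}" "{1}"]
    by (simp add: compute algebra_simps)
qed

end

section \<open>The extremal values\<close>

lemma ex_two_rows:
  fixes v :: "int ^ 'd" and a b :: real
  assumes "CARD('d) \<ge> 3" "0 < a" "a < b" "v \<noteq> 0" "\<forall>n. int n *s v \<in> lattice_box n"
  shows "\<exists>n L i c \<theta> \<epsilon>. two_rows v n L i c \<theta> \<epsilon> a b"
proof -
  obtain i where i: "v $ i \<noteq> 0" using assms(4) by (auto simp: vec_eq_iff)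
  have "2 \<le> card (UNIV - {i})" using assms(1) by simp
  then obtain T where "T \<subseteq> UNIV - {i}" "card T = 2"
    by (rule obtain_subset_with_card_n)
  then obtain j k where jk: "j \<noteq> i" "k \<noteq> i" "j \<noteq> k" by (auto simp: card_2_iff)
  obtain N :: nat where N: "(2 * a + 2 * (b - a)) / (b - a) < N"
    using reals_Archimedean2 by blast
  \<comment> \<open>\<open>N\<close> secures \<open>L_large\<close>, and the summand 4 secures four
    positions on each row; \<open>L\<close> is at least \<open>n\<close> because
    \<open>v $ i\<close> is a nonzero integer.\<close>
  define n where "n = N + 4"
  have "4 \<le> n" by (simp add: n_def)
  define c where "c r = (if r then j else k)" for r :: bool
  define \<epsilon> :: "bool \<Rightarrow> int" where "\<epsilon> r = (if v $ c r \<le> 0 then 1 else - 1)" for r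
  define L where "L = nat (int n * (sgn (v $ i) * v $ i))"
  have abs: "sgn (v $ i) * v $ i = \<bar>v $ i\<bar>" by (simp add: abs_sgn mult.commute)
  have L: "int L = int n * (sgn (v $ i) * v $ i)" by (simp add: L_def abs)
  have "int n * 1 \<le> int n * \<bar>v $ i\<bar>" using i by (intro mult_left_mono) auto
  then have "n \<le> L" using L abs by simp
  have "2 * a + 2 * (b - a) \<le> (b - a) * N"
    using N assms(3) by (simp add: divide_less_eq mult.commute)
  also have "\<dots> \<le> (b - a) * L"
    using \<open>n \<le> L\<close> assms(3) by (intro mult_left_mono) (auto simp: n_def)
  finally have "2 * a + 2 * (b - a) \<le> (b - a) * L" .
  then have "two_rows v n L i c (sgn (v $ i)) \<epsilon> a b"
    using assms i jk L \<open>n \<le> L\<close> \<open>4 \<le> n\<close> by unfold_locales (auto simp: c_def \<epsilon>_def sgn_if)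
  then show ?thesis by blast
qed

lemma deriv_values_bounds:
  assumes "0 < a" "a < b" "\<forall>n. int n *s v \<in> lattice_box n"
  shows "x \<in> deriv_values v a b 1 \<Longrightarrow> x \<in> {0..b - a}"
    "x \<in> deriv_values v a b 2 \<Longrightarrow> x \<in> {- (b - a)..b - a}"
    "x \<in> deriv_values v a b 3 \<Longrightarrow> x \<in> {- (b - a)..b - a}"
    "x \<in> deriv_values v a b 4 \<Longrightarrow> x \<in> {- (2 * (b - a))..2 * (b - a)}"
proof -
  have *: "\<exists>n S \<omega>. finite_graph (box_edges n) 0 (int n *s v) \<and> card S = k \<and>
      x = edges_deriv a b S (min_time (box_edges n) 0 (int n *s v)) \<omega> \<and> (\<forall>e\<in>box_edges n. 0 \<le> \<omega> e)"
    if x: "x \<in> deriv_values v a b k" for k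
  proof -
    obtain n S \<omega> where "x = edges_deriv a b S (passage_time v n) \<omega>" "card S = k"
      and \<omega>: "\<omega> \<in> environments a b n"
      using x unfolding deriv_values_def by blast
    moreover have "\<forall>e\<in>box_edges n. 0 \<le> \<omega> e"
      using \<omega> assms(1,2) unfolding environments_def by (auto dest!: PiE_mem)
    moreover have "finite_graph (box_edges n) 0 (int n *s v)"
      using assms(3) by (intro finite_graph_box) auto
    ultimately show ?thesis unfolding passage_time_eq_min_time by blast
  qed
  have ab: "0 \<le> a" "a \<le> b" using assms by simp_all
  note bounds = finite_graph.edges_deriv_bounds1[OF _ ab] finite_graph.edges_deriv_bounds2[OF _ ab]
    finite_graph.edges_deriv_bounds3[OF _ ab] finite_graph.edges_deriv_bounds4[OF _ ab]
  show "x \<in> {0..b - a}" if x: "x \<in> deriv_values v a b 1"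
  proof -
    obtain n S \<omega> where S: "finite_graph (box_edges n) 0 (int n *s v)" "card S = 1"
      "x = edges_deriv a b S (min_time (box_edges n) 0 (int n *s v)) \<omega>" "\<forall>e\<in>box_edges n. 0 \<le> \<omega> e"
      using *[OF x] by blast
    obtain e where e: "S = {e}" using S(2) by (rule card_1_singletonE)
    show ?thesis unfolding S(3) e by (rule bounds(1)[OF S(1)]) (use S(4) in simp)
  qed
  show "x \<in> {- (b - a)..b - a}" if x: "x \<in> deriv_values v a b 2"
  proof -
    obtain n S \<omega> where S: "finite_graph (box_edges n) 0 (int n *s v)" "card S = 2"
      "x = edges_deriv a b S (min_time (box_edges n) 0 (int n *s v)) \<omega>" "\<forall>e\<in>box_edges n. 0 \<le> \<omega> e"
      using *[OF x] by blast
    obtain e1 e2 where e: "S = {e1, e2}" "e1 \<noteq> e2" using S(2) unfolding card_2_iff by blast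
    show ?thesis unfolding S(3) e(1) by (rule bounds(2)[OF S(1) _ e(2)]) (use S(4) in simp)
  qed
  show "x \<in> {- (b - a)..b - a}" if x: "x \<in> deriv_values v a b 3"
  proof -
    obtain n S \<omega> where S: "finite_graph (box_edges n) 0 (int n *s v)" "card S = 3"
      "x = edges_deriv a b S (min_time (box_edges n) 0 (int n *s v)) \<omega>" "\<forall>e\<in>box_edges n. 0 \<le> \<omega> e"
      using *[OF x] by blast
    obtain e1 e2 e3 where e: "S = {e1, e2, e3}" "distinct [e1, e2, e3]"
      using S(2) unfolding card_3_iff by force
    show ?thesis unfolding S(3) e(1) by (rule bounds(3)[OF S(1) _ e(2)]) (use S(4) in simp)
  qed
  show "x \<in> {- (2 * (b - a))..2 * (b - a)}" if x: "x \<in> deriv_values v a b 4"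
  proof -
    obtain n S \<omega> where S: "finite_graph (box_edges n) 0 (int n *s v)" "card S = Suc 3"
      "x = edges_deriv a b S (min_time (box_edges n) 0 (int n *s v)) \<omega>" "\<forall>e\<in>box_edges n. 0 \<le> \<omega> e"
      using *[OF x] by auto
    obtain e1 T where T: "S = insert e1 T" "e1 \<notin> T" "card T = 3"
      using S(2) unfolding card_Suc_eq by blast
    obtain e2 e3 e4 where "T = {e2, e3, e4}" "distinct [e2, e3, e4]"
      using T(3) unfolding card_3_iff by force
    then have e: "S = {e1, e2, e3, e4}" "distinct [e1, e2, e3, e4]" using T by simp_all
    show ?thesis unfolding S(3) e(1) by (rule bounds(4)[OF S(1) _ e(2)]) (use S(4) in simp)
  qed
qed

lemma U_const_eq:
  assumes "a < b" "u * (b - a) \<in> deriv_values v a b k" "\<And>x. x \<in> deriv_values v a b k \<Longrightarrow> x \<le> u * (b - a)"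
  shows "U_const v a b k = u"
  using assms Greatest_equality[of "\<lambda>x. x \<in> deriv_values v a b k" "u * (b - a)"]
  by (simp add: U_const_def)

lemma L_const_eq:
  assumes "a < b" "u * (b - a) \<in> deriv_values v a b k" "\<And>x. x \<in> deriv_values v a b k \<Longrightarrow> u * (b - a) \<le> x"
  shows "L_const v a b k = u"
  using assms Least_equality[of "\<lambda>x. x \<in> deriv_values v a b k" "u * (b - a)"]
  by (simp add: L_const_def)

theorem theorem1p2:
  fixes v :: "int ^ 'd" and a b :: real
  assumes "CARD('d) \<ge> 3"
    and "0 < a" and "a < b"
    and "v \<noteq> 0"
    and "\<forall>n. int n *s v \<in> lattice_box n"
  shows "(\<forall>k\<in>{1..4}.
            (\<exists>m\<in>deriv_values v a b k. \<forall>x\<in>deriv_values v a b k. x \<le> m) \<and>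
            (\<exists>m\<in>deriv_values v a b k. \<forall>x\<in>deriv_values v a b k. m \<le> x)) \<and>
         (U_const v a b 1, U_const v a b 2, U_const v a b 3, U_const v a b 4) = (1, 1, 1, 2) \<and>
         (L_const v a b 1, L_const v a b 2, L_const v a b 3, L_const v a b 4) = (0, -1, -1, -2)"
proof -
  obtain n L i c \<theta> \<epsilon> where "two_rows v n L i c \<theta> \<epsilon> a b"
    using ex_two_rows[OF assms] by blast
  then interpret two_rows v n L i c \<theta> \<epsilon> a b .
  note mem = extremal_deriv_values
  note bound = deriv_values_bounds[OF assms(2,3,5), unfolded atLeastAtMost_iff]
  have "U_const v a b 1 = 1" "U_const v a b 2 = 1" "U_const v a b 3 = 1" "U_const v a b 4 = 2"
    using mem bound assms(3) by (auto intro!: U_const_eq)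
  moreover have "L_const v a b 1 = 0" "L_const v a b 2 = - 1" "L_const v a b 3 = - 1" "L_const v a b 4 = - 2"
    using mem bound assms(3) by (auto intro!: L_const_eq)
  \<comment> \<open>\<open>GREATEST\<close> and \<open>LEAST\<close> have meaning only if the
    extrema are attained, which the same memberships and bounds show.\<close>
  moreover have "(\<exists>m\<in>deriv_values v a b k. \<forall>x\<in>deriv_values v a b k. x \<le> m) \<and>
      (\<exists>m\<in>deriv_values v a b k. \<forall>x\<in>deriv_values v a b k. m \<le> x)" if "k \<in> {1..4}" for k
  proof -
    from that consider "k = 1" | "k = 2" | "k = 3" | "k = 4" by fastforce
    then show ?thesis
    proof cases
      case 1
      then show ?thesis using mem(1,2) bound(1) by blast
    next
      case 2
      then show ?thesis using mem(3,4) bound(2) by blast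
    next
      case 3
      then show ?thesis using mem(5,6) bound(3) by blast
    next
      case 4
      then show ?thesis using mem(7,8) bound(4) by blast
    qed
  qed
  ultimately show ?thesis by simp
qed

end
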